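(* Let $\lambda/\mu$ and $\nu/\rho$ be any two skew shapes. Then $$s_{\lfloor\frac{\lambda+\nu}{2}\rfloor/\lfloor\frac{\mu+\rho}{2}\rfloor}\; s_{\lceil\frac{\lambda+\nu}{2}\rceil/\lceil\frac{\mu+\rho}{2}\rceil} - s_{\lambda/\mu}\, s_{\nu/\rho}$$ is Schur nonnegative.
   Context: Partitions are padded with zeros; the operations $\lambda+\nu$, division by $2$, $\lfloor\cdot\rfloor$ and $\lceil\cdot\rceil$ are performed coordinatewise. A skew shape $\lambda/\mu$ is a pair of partitions with $\mu_i\le\lambda_i$ for all $i$; $s_{\lambda/\mu}$ is the skew Schur function. A symmetric function is Schur nonnegative if it is a nonnegative linear combination of Schur functions. *)

theory Defs
  imports Complex_Main "HOL-Library.FuncSet" "HOL-Library.Poly_Mapping"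
begin

text \<open>Rows and columns are indexed from 0; a partition is the whole sequence of its parts, padded
  with zeros.\<close>

definition is_partition :: "(nat \<Rightarrow> nat) \<Rightarrow> bool" where
  "is_partition lam \<longleftrightarrow> antimono lam \<and> finite {i. lam i \<noteq> 0}"

definition skew_shape :: "(nat \<Rightarrow> nat) \<Rightarrow> (nat \<Rightarrow> nat) \<Rightarrow> bool" where
  "skew_shape lam \<mu> \<longleftrightarrow> is_partition lam \<and> is_partition \<mu> \<and> (\<forall>i. \<mu> i \<le> lam i)"

definition floor_half_sum :: "(nat \<Rightarrow> nat) \<Rightarrow> (nat \<Rightarrow> nat) \<Rightarrow> nat \<Rightarrow> nat" where
  "floor_half_sum lam \<nu> = (\<lambda>i. nat \<lfloor>(real (lam i) + real (\<nu> i)) / 2\<rfloor>)"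

definition ceiling_half_sum :: "(nat \<Rightarrow> nat) \<Rightarrow> (nat \<Rightarrow> nat) \<Rightarrow> nat \<Rightarrow> nat" where
  "ceiling_half_sum lam \<nu> = (\<lambda>i. nat \<lceil>(real (lam i) + real (\<nu> i)) / 2\<rceil>)"

definition skew_diagram :: "(nat \<Rightarrow> nat) \<Rightarrow> (nat \<Rightarrow> nat) \<Rightarrow> (nat \<times> nat) set" where
  "skew_diagram lam \<mu> = {(i, j). \<mu> i \<le> j \<and> j < lam i}"

text \<open>Tableaux are extensional on the diagram, so that distinct functions are distinct fillings and
  counting them makes sense.\<close>

definition ssyt :: "(nat \<Rightarrow> nat) \<Rightarrow> (nat \<Rightarrow> nat) \<Rightarrow> (nat \<times> nat \<Rightarrow> nat) set" where
  "ssyt lam \<mu> = {T \<in> extensional (skew_diagram lam \<mu>).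
     (\<forall>i j j'. (i, j) \<in> skew_diagram lam \<mu> \<longrightarrow> (i, j') \<in> skew_diagram lam \<mu> \<longrightarrow> j < j' \<longrightarrow>
        T (i, j) \<le> T (i, j')) \<and>
     (\<forall>i i' j. (i, j) \<in> skew_diagram lam \<mu> \<longrightarrow> (i', j) \<in> skew_diagram lam \<mu> \<longrightarrow> i < i' \<longrightarrow>
        T (i, j) < T (i', j))}"

definition ssyt_content ::
    "(nat \<Rightarrow> nat) \<Rightarrow> (nat \<Rightarrow> nat) \<Rightarrow> (nat \<Rightarrow>\<^sub>0 nat) \<Rightarrow> (nat \<times> nat \<Rightarrow> nat) set" where
  "ssyt_content lam \<mu> \<alpha> = {T \<in> ssyt lam \<mu>.
     \<forall>k. card {b \<in> skew_diagram lam \<mu>. T b = k} = Poly_Mapping.lookup \<alpha> k}"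

text \<open>A formal power series over the integers in the variables $x_0, x_1, \ldots$ is given by its
  coefficients; a finitely supported exponent vector \<open>\<alpha>\<close> stands for the monomial
  $\prod_k x_k^{\alpha_k}$. Symmetric functions live in this ring.\<close>

type_synonym series = "(nat \<Rightarrow>\<^sub>0 nat) \<Rightarrow> int"

definition series_times :: "series \<Rightarrow> series \<Rightarrow> series"  (infixl \<open>\<odot>\<close> 70) where
  "f \<odot> g = (\<lambda>\<alpha>. \<Sum>(\<beta>, \<gamma>)\<in>{(\<beta>, \<gamma>). \<beta> + \<gamma> = \<alpha>}. f \<beta> * g \<gamma>)"

text \<open>The coefficient of $x^\alpha$ in $s_{\lambda/\mu} = \sum_T x^T$ is the number of semistandard
  tableaux of shape $\lambda/\mu$ and content $\alpha$.\<close>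

definition skew_schur :: "(nat \<Rightarrow> nat) \<Rightarrow> (nat \<Rightarrow> nat) \<Rightarrow> series" where
  "skew_schur lam \<mu> = (\<lambda>\<alpha>. int (card (ssyt_content lam \<mu> \<alpha>)))"

definition schur :: "(nat \<Rightarrow> nat) \<Rightarrow> series" where
  "schur lam = skew_schur lam (\<lambda>_. 0)"

definition schur_nonnegative :: "series \<Rightarrow> bool" where
  "schur_nonnegative f \<longleftrightarrow>
     (\<exists>P c. finite P \<and> (\<forall>\<kappa>\<in>P. is_partition \<kappa> \<and> c \<kappa> \<ge> 0) \<and>
            f = (\<lambda>\<alpha>. \<Sum>\<kappa>\<in>P. c \<kappa> * schur \<kappa> \<alpha>))"

text \<open>For partitions, the sets that are summed over or counted above are finite, so \<open>sum\<close> and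
  \<open>card\<close> never take their default value 0.\<close>

lemma finite_series_times_index: "finite {(\<beta>, \<gamma>). \<beta> + \<gamma> = (\<alpha> :: nat \<Rightarrow>\<^sub>0 nat)}"
proof -
  let ?K = "Poly_Mapping.keys \<alpha>"
  let ?C = "\<Union>k\<in>?K. {..Poly_Mapping.lookup \<alpha> k}"
  define B where "B = {f. \<forall>k. (k \<in> ?K \<longrightarrow> f k \<in> ?C) \<and> (k \<notin> ?K \<longrightarrow> f k = 0)}"
  define S where "S = {\<beta>. Poly_Mapping.lookup \<beta> \<in> B}"
  have "finite B"
    unfolding B_def by (rule finite_set_of_finite_funs) auto
  then have "finite S"
    using finite_vimageI[of B Poly_Mapping.lookup]
    by (simp add: S_def vimage_def inj_def lookup_inject)
  have le: "\<beta> \<in> S" if "\<beta> + \<gamma> = \<alpha>" for \<beta> \<gamma>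
  proof -
    have "Poly_Mapping.lookup \<beta> k \<le> Poly_Mapping.lookup \<alpha> k" for k
      unfolding that[symmetric] by (simp add: lookup_add)
    moreover have "Poly_Mapping.lookup \<alpha> k = 0" if "k \<notin> ?K" for k
      using that by (simp add: in_keys_iff)
    ultimately show ?thesis
      unfolding S_def B_def mem_Collect_eq by (intro allI conjI impI UN_I) (assumption, simp, metis le_zero_eq)
  qed
  have "{(\<beta>, \<gamma>). \<beta> + \<gamma> = \<alpha>} \<subseteq> S \<times> S"
  proof (rule subrelI, intro SigmaI)
    fix \<beta> \<gamma> assume "(\<beta>, \<gamma>) \<in> {(\<beta>, \<gamma>). \<beta> + \<gamma> = \<alpha>}"
    then show "\<beta> \<in> S" "\<gamma> \<in> S"
      using le[of \<beta> \<gamma>] le[of \<gamma> \<beta>] by (simp_all add: add.commute)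
  qed
  then show ?thesis
    by (rule finite_subset) (intro finite_cartesian_product \<open>finite S\<close>)
qed

lemma finite_skew_diagram:
  assumes "is_partition lam"
  shows "finite (skew_diagram lam \<mu>)"
proof -
  have "skew_diagram lam \<mu> \<subseteq> (SIGMA i:{i. lam i \<noteq> 0}. {..<lam i})"
    by (auto simp: skew_diagram_def)
  then show ?thesis
    by (rule finite_subset) (use assms in \<open>auto simp: is_partition_def\<close>)
qed

lemma finite_ssyt_content:
  assumes "is_partition lam"
  shows "finite (ssyt_content lam \<mu> \<alpha>)"
proof -
  let ?D = "skew_diagram lam \<mu>"
  have fin: "finite ?D" by (rule finite_skew_diagram[OF assms])
  have "T b \<in> Poly_Mapping.keys \<alpha>" if T: "T \<in> ssyt_content lam \<mu> \<alpha>" and b: "b \<in> ?D" for T b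
  proof -
    have "b \<in> {b' \<in> ?D. T b' = T b}"
      using b by simp
    then have "card {b' \<in> ?D. T b' = T b} \<noteq> 0"
      using fin card_gt_0_iff[of "{b' \<in> ?D. T b' = T b}"] by fastforce
    then show ?thesis
      using T by (simp add: ssyt_content_def in_keys_iff)
  qed
  then have "ssyt_content lam \<mu> \<alpha> \<subseteq> (\<Pi>\<^sub>E b\<in>?D. Poly_Mapping.keys \<alpha>)"
    by (auto simp: PiE_def Pi_def ssyt_content_def ssyt_def)
  then show ?thesis
    by (rule finite_subset) (intro finite_PiE fin finite_keys)
qed

lemma skew_shape_floor_half_sum:
  assumes "skew_shape lam \<mu>" "skew_shape \<nu> \<rho>"
  shows "skew_shape (floor_half_sum lam \<nu>) (floor_half_sum \<mu> \<rho>)"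
proof -
  have mono: "floor_half_sum a b i \<le> floor_half_sum a' b' i'"
    if "a i \<le> a' i'" "b i \<le> b' i'" for a b a' b' i i'
    unfolding floor_half_sum_def using that by (intro nat_mono floor_mono divide_right_mono add_mono) simp_all
  have "is_partition (floor_half_sum a b)" if "is_partition a" "is_partition b" for a b
  proof -
    have "{i. floor_half_sum a b i \<noteq> 0} \<subseteq> {i. a i \<noteq> 0} \<union> {i. b i \<noteq> 0}"
      by (auto simp: floor_half_sum_def)
    then have "finite {i. floor_half_sum a b i \<noteq> 0}"
      using that unfolding is_partition_def by (meson finite_UnI finite_subset)
    moreover have "antimono (floor_half_sum a b)"
      using that unfolding is_partition_def antimono_def by (simp add: mono)
    ultimately show ?thesis
      by (simp add: is_partition_def)
  qed
  then show ?thesis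
    using assms by (simp add: skew_shape_def mono)
qed

lemma skew_shape_ceiling_half_sum:
  assumes "skew_shape lam \<mu>" "skew_shape \<nu> \<rho>"
  shows "skew_shape (ceiling_half_sum lam \<nu>) (ceiling_half_sum \<mu> \<rho>)"
proof -
  have mono: "ceiling_half_sum a b i \<le> ceiling_half_sum a' b' i'"
    if "a i \<le> a' i'" "b i \<le> b' i'" for a b a' b' i i'
    unfolding ceiling_half_sum_def using that by (intro nat_mono ceiling_mono divide_right_mono add_mono) simp_all
  have "is_partition (ceiling_half_sum a b)" if "is_partition a" "is_partition b" for a b
  proof -
    have "{i. ceiling_half_sum a b i \<noteq> 0} \<subseteq> {i. a i \<noteq> 0} \<union> {i. b i \<noteq> 0}"
      by (auto simp: ceiling_half_sum_def)
    then have "finite {i. ceiling_half_sum a b i \<noteq> 0}"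
      using that unfolding is_partition_def by (meson finite_UnI finite_subset)
    moreover have "antimono (ceiling_half_sum a b)"
      using that unfolding is_partition_def antimono_def by (simp add: mono)
    ultimately show ?thesis
      by (simp add: is_partition_def)
  qed
  then show ?thesis
    using assms by (simp add: skew_shape_def mono)
qed

end

theory Submission imports Defs "HOL-Combinatorics.Permutations" begin

text \<open>Exchanging the entries of two tableaux \<open>t\<close>, \<open>u\<close> inside a suitable region turns the shapes
  \<open>lam/\<mu>\<close>, \<open>\<nu>/\<rho>\<close> into their coordinatewise maximum and minimum; this cell transfer is injective and
  preserves the content. To obtain Schur nonnegativity, and not just monomial nonnegativity, one
  needs a Littlewood--Richardson rule for the product that cell transfer respects. The rule used
  here scans the columns of both tableaux simultaneously from right to left, increasingly within a
  column, except that when \<open>k\<close> and \<open>k + 1\<close> lie in different tableaux their order depends on in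
  which of the two columns the inner shape and the letters smaller than \<open>k\<close> reach further down.
  The coefficient of \<open>s\<^sub>\<kappa>\<close> is the number
  of pairs of content \<open>\<kappa>\<close> in which \<open>k + 1\<close> never outnumbers \<open>k\<close> during the scan: as in Stembridge's
  proof of the classical rule, all other pairs cancel in the product with the Vandermonde
  determinant, by a Bender--Knuth toggle of the part not yet scanned at the first violation. Cell
  transfer only relaxes the scanning condition, which proves the inequality for maximum and minimum.
  Applying it to \<open>\<nu>/\<rho>\<close> shifted by one column and then without a shift replaces row lengths
  \<open>a \<ge> b + 2\<close> by \<open>a - 1\<close>, \<open>b + 1\<close>, and iterating this ends at the ceiling and the floor.\<close>

text \<open>Cell transfer swaps the row lengths of the two tableaux at equal level and row, so the
  counts \<open>excess2\<close> taken after whole columns cannot change; only the order inside a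
  column is at risk. That order is governed by \<open>height_diff\<close> at level \<open>k\<close>,
  whose absolute value a transfer preserves, at most turning a negative value positive. This
  dictates the tie rule: if \<open>t\<close> led in a tie, the sequence 0, -1, 0 would be harmless
  and could turn into the dip 0, 1, 0. The toggle for \<open>k\<close> and \<open>Suc k\<close>
  alters level \<open>Suc k\<close> only, hence never the leader at level \<open>k\<close>, as an
  involution requires. The price of this order is that a violation may occur in the middle of a
  column, so that the two tableaux may have to be toggled up to different columns.

  Coordinatewise maximum and minimum leave a pair of comparable shapes as it is. The shift by one
  column is what makes a further transfer effective on such a pair.\<close>

section \<open>Chains of row lengths\<close>

text \<open>A tableau is encoded by the row lengths \<open>t k r\<close> of the subtableau of letters smaller than
  \<open>k\<close>, so the letter \<open>k\<close> occupies the columns \<open>t k r..<t (Suc k) r\<close> of row \<open>r\<close>. The number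
  \<open>n\<close> bounds the rows.\<close>

definition interlacing :: "nat \<Rightarrow> (nat \<Rightarrow> nat \<Rightarrow> nat) \<Rightarrow> bool" where
  "interlacing n t \<longleftrightarrow> (\<forall>k r. t k r \<le> t (Suc k) r) \<and> (\<forall>k r. t (Suc k) (Suc r) \<le> t k r) \<and>
     (\<forall>k. \<forall>r\<ge>n. t k r = 0)"

definition right_cells :: "nat \<Rightarrow> nat \<Rightarrow> (nat \<Rightarrow> nat) \<Rightarrow> int" where
  "right_cells n j x = (\<Sum>r<n. int (x r - j))"

definition col_height :: "nat \<Rightarrow> nat \<Rightarrow> (nat \<Rightarrow> nat) \<Rightarrow> nat" where
  "col_height n j x = card {r. r < n \<and> j < x r}"

text \<open>A second difference along the chain: the occurrences of \<open>Suc k\<close> minus those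
  of \<open>k\<close> in column \<open>j\<close> and all columns to its right.\<close>

definition excess :: "nat \<Rightarrow> (nat \<Rightarrow> nat \<Rightarrow> nat) \<Rightarrow> nat \<Rightarrow> nat \<Rightarrow> int" where
  "excess n t j k = right_cells n j (t (Suc (Suc k))) - 2 * right_cells n j (t (Suc k)) + right_cells n j (t k)"

lemma interlacingD:
  assumes "interlacing n t"
  shows "t k r \<le> t (Suc k) r" "t (Suc k) (Suc r) \<le> t k r" "r \<ge> n \<Longrightarrow> t k r = 0"
  using assms by (auto simp: interlacing_def)

lemma interlacing_antimono:
  assumes "interlacing n t" "r \<le> r'"
  shows "t k r' \<le> t k r"
  using assms(2)
proof (rule dec_induct)
  fix i show "t k i \<le> t k r \<Longrightarrow> t k (Suc i) \<le> t k r"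
    using interlacingD(1,2)[OF assms(1)] by (meson le_trans)
qed simp

lemma interlacing_mono:
  assumes "interlacing n t" "k \<le> k'"
  shows "t k r \<le> t k' r"
  using assms(2) by (rule dec_induct) (use interlacingD(1)[OF assms(1)] in \<open>auto intro: le_trans\<close>)

lemma right_cells_Suc: "right_cells n j x = right_cells n (Suc j) x + int (col_height n j x)"
proof -
  have "int (col_height n j x) = (\<Sum>r<n. of_bool (j < x r))"
    by (simp add: col_height_def sum.If_cases of_bool_def Int_def lessThan_def)
  moreover have "int (x r - j) = int (x r - Suc j) + of_bool (j < x r)" for r
    by auto
  ultimately show ?thesis
    by (simp add: right_cells_def sum.distrib)
qed

lemma down_closed_eq_lessThan:
  fixes A :: "nat set"
  assumes "finite A" "\<And>r. Suc r \<in> A \<Longrightarrow> r \<in> A"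
  shows "A = {..<card A}"
proof -
  have down: "r' \<in> A" if "r \<in> A" "r' \<le> r" for r r'
    using that(2,1) by (induction rule: inc_induct) (auto intro: assms(2))
  define m where "m = (LEAST i. i \<notin> A)"
  have "\<exists>i. i \<notin> A"
    using assms(1) by (metis ex_new_if_finite infinite_UNIV_nat)
  then have "m \<notin> A" "\<And>i. i < m \<Longrightarrow> i \<in> A"
    unfolding m_def by (rule LeastI_ex) (use not_less_Least in blast)
  then have "A = {..<m}"
    using down by (auto simp: not_less[symmetric])
  then show ?thesis by simp
qed

lemma less_col_height_iff:
  assumes "interlacing n t"
  shows "r < col_height n j (t k) \<longleftrightarrow> j < t k r"
proof -
  let ?A = "{r. r < n \<and> j < t k r}"
  have "?A = {..<card ?A}"
    by (rule down_closed_eq_lessThan)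
      (use interlacing_antimono[OF assms, of _ "Suc _"] in \<open>auto intro: less_le_trans\<close>)
  then have "r < card ?A \<longleftrightarrow> r \<in> ?A" by blast
  then show ?thesis
    using interlacingD(3)[OF assms, of r k] by (cases "r < n") (auto simp: col_height_def)
qed

text \<open>A column contains each letter at most once.\<close>

lemma col_height_step:
  assumes "interlacing n t"
  shows "col_height n j (t k) \<le> col_height n j (t (Suc k))"
    and "col_height n j (t (Suc k)) \<le> Suc (col_height n j (t k))"
proof -
  note iff = less_col_height_iff[OF assms]
  show "col_height n j (t k) \<le> col_height n j (t (Suc k))"
    using iff[of "col_height n j (t (Suc k))" j k] iff[of "col_height n j (t (Suc k))" j "Suc k"]
      interlacingD(1)[OF assms, of k "col_height n j (t (Suc k))"] by linarith
  show "col_height n j (t (Suc k)) \<le> Suc (col_height n j (t k))"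
    using iff[of "col_height n j (t k)" j k] iff[of "Suc (col_height n j (t k))" j "Suc k"]
      interlacingD(2)[OF assms, of k "col_height n j (t k)"] by linarith
qed

lemma col_height_antimono: "j \<le> j' \<Longrightarrow> col_height n j' x \<le> col_height n j x"
  unfolding col_height_def by (rule card_mono) auto

lemma excess_Suc:
  "excess n t j k = excess n t (Suc j) k + int (col_height n j (t (Suc (Suc k))))
     - 2 * int (col_height n j (t (Suc k))) + int (col_height n j (t k))"
  by (simp add: excess_def right_cells_Suc[of n j])

section \<open>Truncated Bender--Knuth toggles\<close>

text \<open>With the levels \<open>k\<close> and \<open>Suc (Suc k)\<close> fixed, interlacing lets
  \<open>t (Suc k) r\<close> range exactly over the interval from \<open>lower\<close> to
  \<open>upper\<close>. The cells of this interval are the letters \<open>k\<close> and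
  \<open>Suc k\<close> of row \<open>r\<close> that are not stacked on each other.\<close>

definition lower :: "(nat \<Rightarrow> nat \<Rightarrow> nat) \<Rightarrow> nat \<Rightarrow> nat \<Rightarrow> nat" where
  "lower t k r = max (t k r) (t (Suc (Suc k)) (Suc r))"

definition upper :: "(nat \<Rightarrow> nat \<Rightarrow> nat) \<Rightarrow> nat \<Rightarrow> nat \<Rightarrow> nat" where
  "upper t k r = (case r of 0 \<Rightarrow> t (Suc (Suc k)) 0 | Suc r' \<Rightarrow> min (t (Suc (Suc k)) r) (t k r'))"

text \<open>Reflecting \<open>t (Suc k) r\<close> in its interval is the Bender--Knuth involution;
  cutting the interval at \<open>J\<close> confines it to the columns left of
  \<open>J\<close>.\<close>

definition toggle :: "nat \<Rightarrow> nat \<Rightarrow> (nat \<Rightarrow> nat \<Rightarrow> nat) \<Rightarrow> nat \<Rightarrow> nat \<Rightarrow> nat" where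
  "toggle J k t = t(Suc k := \<lambda>r. if lower t k r < J
     then lower t k r + min (upper t k r) J - t (Suc k) r else t (Suc k) r)"

text \<open>No row has unpaired letters \<open>k\<close> on both sides of the cut. Then
  \<open>t (Suc k) r\<close> lies in the cut interval, so the reflection makes sense and its natural
  number subtraction is exact.\<close>

definition fits :: "nat \<Rightarrow> nat \<Rightarrow> (nat \<Rightarrow> nat \<Rightarrow> nat) \<Rightarrow> bool" where
  "fits J k t \<longleftrightarrow> (\<forall>r. lower t k r < J \<longrightarrow> t (Suc k) r \<le> J)"

lemma toggle_level: "toggle J k t (Suc k) r = (if lower t k r < J
     then lower t k r + min (upper t k r) J - t (Suc k) r else t (Suc k) r)"
  by (simp add: toggle_def)

lemma lower_le: "interlacing n t \<Longrightarrow> lower t k r \<le> t (Suc k) r"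
  by (auto simp: lower_def interlacing_def)

lemma le_upper: "interlacing n t \<Longrightarrow> t (Suc k) r \<le> upper t k r"
  by (auto simp: upper_def interlacing_def split: nat.split)

lemma toggle_bounds:
  assumes "interlacing n t" "fits J k t"
  shows "lower t k r \<le> toggle J k t (Suc k) r" "toggle J k t (Suc k) r \<le> upper t k r"
    "lower t k r < J \<Longrightarrow> toggle J k t (Suc k) r \<le> J"
  using lower_le[OF assms(1), of k r] le_upper[OF assms(1), of k r] assms(2)
  by (auto simp: toggle_level fits_def)

lemma toggle_other: "i \<noteq> Suc k \<Longrightarrow> toggle J k t i = t i"
  by (simp add: toggle_def)

lemma lower_upper_toggle [simp]:
  "lower (toggle J k t) k = lower t k" "upper (toggle J k t) k = upper t k"
  by (auto simp: lower_def upper_def toggle_def split: nat.split)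

lemma interlacing_toggle:
  assumes "interlacing n t" "fits J k t"
  shows "interlacing n (toggle J k t)"
proof -
  let ?t = "toggle J k t"
  note b = toggle_bounds[OF assms]
  note d = interlacingD[OF assms(1)]
  have "?t i r \<le> ?t (Suc i) r" for i r
  proof -
    consider "i = k" | "i = Suc k" | "i \<noteq> k" "i \<noteq> Suc k" by blast
    then show ?thesis
    proof cases
      case 1
      then show ?thesis using b(1)[of r] by (simp add: toggle_other lower_def)
    next
      case 2
      then show ?thesis using b(2)[of r] by (simp add: toggle_other upper_def split: nat.splits)
    qed (simp add: toggle_other d(1))
  qed
  moreover have "?t (Suc i) (Suc r) \<le> ?t i r" for i r
  proof -
    consider "i = k" | "i = Suc k" | "i \<noteq> k" "i \<noteq> Suc k" by blast
    then show ?thesis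
    proof cases
      case 1
      then show ?thesis using b(2)[of "Suc r"] by (simp add: toggle_other upper_def)
    next
      case 2
      then show ?thesis using b(1)[of r] by (simp add: toggle_other lower_def)
    qed (simp add: toggle_other d(2))
  qed
  moreover have "?t i r = 0" if "r \<ge> n" for i r
  proof (cases "i = Suc k")
    case True
    have "upper t k r = 0"
      using that d(3) by (auto simp: upper_def split: nat.split)
    then show ?thesis using b(2)[of r] True by simp
  qed (use that d(3) in \<open>simp add: toggle_other\<close>)
  ultimately show ?thesis by (simp add: interlacing_def)
qed

lemma toggle_toggle:
  assumes "interlacing n t" "fits J k t"
  shows "toggle J k (toggle J k t) = t"
proof -
  have "toggle J k (toggle J k t) (Suc k) r = t (Suc k) r" for r
    using lower_le[OF assms(1), of k r] le_upper[OF assms(1), of k r] assms(2)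
    by (auto simp: fits_def toggle_level)
  then show ?thesis
    by (intro ext, rename_tac i r, case_tac "i = Suc k") (simp_all add: toggle_other)
qed

lemma toggle_right:
  assumes "interlacing n t" "fits J k t" "J \<le> j"
  shows "right_cells n j (toggle J k t i) = right_cells n j (t i)"
    and "col_height n j (toggle J k t i) = col_height n j (t i)"
proof -
  have eq: "toggle J k t i r - j = t i r - j" for r
  proof (cases "i = Suc k \<and> lower t k r < J")
    case True
    then have "toggle J k t i r \<le> J" "t i r \<le> J"
      using toggle_bounds(3)[OF assms(1,2), of r] assms(2) by (auto simp: fits_def)
    then show ?thesis using assms(3) by simp
  qed (auto simp: toggle_def)
  then show "right_cells n j (toggle J k t i) = right_cells n j (t i)"
    by (simp add: right_cells_def)
  have "j < toggle J k t i r \<longleftrightarrow> j < t i r" for r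
    using eq[of r] by linarith
  then show "col_height n j (toggle J k t i) = col_height n j (t i)"
    by (simp add: col_height_def)
qed

text \<open>\<open>lower\<close> in row \<open>r\<close> and \<open>upper\<close> in row
  \<open>Suc r\<close> are the maximum and the minimum of the same two entries, \<open>t k r\<close>
  and \<open>t (Suc (Suc k)) (Suc r)\<close>. What is left over at row \<open>n\<close> is
  \<open>g 0\<close>.\<close>

lemma sum_lower_upper:
  fixes g :: "nat \<Rightarrow> int"
  assumes "interlacing n t" "g 0 = 0"
  shows "(\<Sum>r<n. g (lower t k r) + g (upper t k r)) = (\<Sum>r<n. g (t k r) + g (t (Suc (Suc k)) r))"
proof -
  have "(\<Sum>r<m. g (lower t k r) + g (upper t k r)) + g (upper t k m)
      = (\<Sum>r<m. g (t k r) + g (t (Suc (Suc k)) r)) + g (t (Suc (Suc k)) m)" for m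
  proof (induction m)
    case (Suc m)
    have "g (lower t k m) + g (upper t k (Suc m)) = g (t k m) + g (t (Suc (Suc k)) (Suc m))"
      by (auto simp: lower_def upper_def max_def min_def)
    then show ?case using Suc by simp
  qed (simp add: upper_def)
  from this[of n] show ?thesis
    using interlacingD(3)[OF assms(1)] assms(2) by (simp add: upper_def split: nat.splits)
qed

text \<open>Row lengths truncated at \<open>J\<close> count the cells left of column
  \<open>J\<close>. There the toggle interchanges the numbers of \<open>k\<close> and
  \<open>Suc k\<close>, whose difference is \<open>excess n t 0 k - excess n t J k\<close>.\<close>

lemma right_cells_toggle:
  assumes "interlacing n t" "fits J k t"
  shows "right_cells n 0 (toggle J k t (Suc k))
    = right_cells n 0 (t (Suc k)) + excess n t 0 k - excess n t J k"
proof -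
  have split: "right_cells n 0 x - right_cells n J x = (\<Sum>r<n. int (min (x r) J))" for x
    unfolding right_cells_def sum_subtractf[symmetric] by (rule sum.cong) auto
  have "right_cells n 0 (toggle J k t (Suc k)) - right_cells n 0 (t (Suc k))
      = (\<Sum>r<n. (int (min (lower t k r) J) + int (min (upper t k r) J)) - 2 * int (min (t (Suc k) r) J))"
    unfolding right_cells_def sum_subtractf[symmetric]
  proof (rule sum.cong)
    fix r
    show "int (toggle J k t (Suc k) r - 0) - int (t (Suc k) r - 0)
      = int (min (lower t k r) J) + int (min (upper t k r) J) - 2 * int (min (t (Suc k) r) J)"
      using lower_le[OF assms(1), of k r] le_upper[OF assms(1), of k r] assms(2)
      by (auto simp: toggle_level fits_def)
  qed simp
  also have "\<dots> = (\<Sum>r<n. int (min (lower t k r) J) + int (min (upper t k r) J))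
      - 2 * (\<Sum>r<n. int (min (t (Suc k) r) J))"
    by (simp add: sum_subtractf sum_distrib_left)
  also have "(\<Sum>r<n. int (min (lower t k r) J) + int (min (upper t k r) J))
      = (\<Sum>r<n. int (min (t k r) J) + int (min (t (Suc (Suc k)) r) J))"
    using sum_lower_upper[OF assms(1), of "\<lambda>x. int (min x J)"] by simp
  finally show ?thesis
    using split[of "t k"] split[of "t (Suc k)"] split[of "t (Suc (Suc k))"]
    by (simp add: excess_def sum.distrib)
qed

section \<open>Yamanouchi pairs and the cancelling involution\<close>

definition excess2 :: "nat \<Rightarrow> (nat \<Rightarrow> nat \<Rightarrow> nat) \<Rightarrow> (nat \<Rightarrow> nat \<Rightarrow> nat) \<Rightarrow> nat \<Rightarrow> nat \<Rightarrow> int" where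
  "excess2 n t u j k = excess n t j k + excess n u j k"

definition height_diff :: "nat \<Rightarrow> (nat \<Rightarrow> nat \<Rightarrow> nat) \<Rightarrow> (nat \<Rightarrow> nat \<Rightarrow> nat) \<Rightarrow> nat \<Rightarrow> nat \<Rightarrow> int" where
  "height_diff n t u j k = int (col_height n j (t k)) - int (col_height n j (u k))"

text \<open>\<open>dips n t u j k\<close> holds if, among the letters \<open>k\<close> and \<open>Suc k\<close>, the column \<open>j\<close> of one tableau has
  only \<open>k\<close>, that of the other has only \<open>Suc k\<close>, and the former tableau is the leader, that is, its
  inner shape and letters smaller than \<open>k\<close> reach further down in column \<open>j\<close>, where \<open>u\<close> leads in
  case of a tie. Only then is \<open>Suc k\<close>
  scanned before \<open>k\<close>, which is why \<open>bad\<close> has a second alternative.\<close>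

definition dips :: "nat \<Rightarrow> (nat \<Rightarrow> nat \<Rightarrow> nat) \<Rightarrow> (nat \<Rightarrow> nat \<Rightarrow> nat) \<Rightarrow> nat \<Rightarrow> nat \<Rightarrow> bool" where
  "dips n t u j k \<longleftrightarrow> height_diff n t u j (Suc (Suc k)) = height_diff n t u j k \<and>
     height_diff n t u j (Suc k) = height_diff n t u j k + (if height_diff n t u j k > 0 then 1 else - 1)"

definition bad :: "nat \<Rightarrow> (nat \<Rightarrow> nat \<Rightarrow> nat) \<Rightarrow> (nat \<Rightarrow> nat \<Rightarrow> nat) \<Rightarrow> nat \<Rightarrow> nat \<Rightarrow> bool" where
  "bad n t u j k \<longleftrightarrow> excess2 n t u j k \<ge> 1 \<or> dips n t u j k \<and> excess2 n t u (Suc j) k \<ge> 0"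

definition yamanouchi :: "nat \<Rightarrow> (nat \<Rightarrow> nat \<Rightarrow> nat) \<Rightarrow> (nat \<Rightarrow> nat \<Rightarrow> nat) \<Rightarrow> bool" where
  "yamanouchi n t u \<longleftrightarrow> (\<forall>j k. \<not> bad n t u j k)"

definition mixed :: "nat \<Rightarrow> (nat \<Rightarrow> nat \<Rightarrow> nat) \<Rightarrow> (nat \<Rightarrow> nat \<Rightarrow> nat) \<Rightarrow> nat \<Rightarrow> nat \<Rightarrow> bool" where
  "mixed n t u j k \<longleftrightarrow> col_height n j (t (Suc (Suc k))) = Suc (col_height n j (t k)) \<and>
     col_height n j (u (Suc k)) = col_height n j (u k) \<and>
     col_height n j (u (Suc (Suc k))) = Suc (col_height n j (u k))"

text \<open>In a critical position the violation happens at the letter \<open>Suc k\<close> of the follower, while the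
  letter of the leader in the same column, \<open>k\<close> or \<open>Suc k\<close>, is not yet scanned. The toggle may
  change the latter without affecting whether the position is critical.\<close>

definition critical :: "nat \<Rightarrow> (nat \<Rightarrow> nat \<Rightarrow> nat) \<Rightarrow> (nat \<Rightarrow> nat \<Rightarrow> nat) \<Rightarrow> nat \<Rightarrow> nat \<Rightarrow> bool" where
  "critical n t u j k \<longleftrightarrow> excess2 n t u (Suc j) k = 0 \<and>
     (if height_diff n t u j k > 0 then mixed n t u j k else mixed n u t j k)"

definition weight :: "nat \<Rightarrow> (nat \<Rightarrow> nat \<Rightarrow> nat) \<Rightarrow> (nat \<Rightarrow> nat \<Rightarrow> nat) \<Rightarrow> nat \<Rightarrow> int" where
  "weight n t u k = right_cells n 0 (t (Suc k)) - right_cells n 0 (t k)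
     + (right_cells n 0 (u (Suc k)) - right_cells n 0 (u k))"

lemma excess2_0: "excess2 n t u 0 k = weight n t u (Suc k) - weight n t u k"
  by (simp add: excess2_def excess_def weight_def)

text \<open>An obstructing row has the letter \<open>k\<close> in both columns \<open>J - 1\<close>
  and \<open>J\<close>, with no letter up to \<open>Suc k\<close> below these cells. So
  \<open>k\<close> comes without \<open>Suc k\<close> in column \<open>J\<close>, and what precedes
  \<open>k\<close> ends at the same row in both columns.\<close>

lemma not_fits:
  assumes t: "interlacing n t" and nf: "\<not> fits J k t"
  shows "col_height n J (t (Suc k)) = Suc (col_height n J (t k))"
    and "col_height n J (t (Suc (Suc k))) = col_height n J (t (Suc k))"
    and "J = Suc j \<Longrightarrow> col_height n J (t k) = col_height n j (t k)"
proof -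
  obtain r where r: "lower t k r < J" "J < t (Suc k) r"
    using nf by (auto simp: fits_def not_le)
  then have lt: "t k r < J" "t (Suc (Suc k)) (Suc r) < J"
    by (auto simp: lower_def)
  note iff = less_col_height_iff[OF t]
  have 1: "col_height n J (t k) \<le> r" "r < col_height n J (t (Suc k))"
    using iff[of r J] r lt by (auto simp: not_less[symmetric])
  then have eq: "col_height n J (t k) = r" "col_height n J (t (Suc k)) = Suc r"
    using col_height_step[OF t, of J k] by auto
  then show "col_height n J (t (Suc k)) = Suc (col_height n J (t k))" by simp
  have "col_height n J (t (Suc (Suc k))) \<le> Suc r"
    using iff[of "Suc r" J "Suc (Suc k)"] lt by auto
  then show "col_height n J (t (Suc (Suc k))) = col_height n J (t (Suc k))"
    using eq col_height_step(1)[OF t, of J "Suc k"] by simp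
  assume J: "J = Suc j"
  then have "col_height n j (t k) \<le> r"
    using iff[of r j k] lt by auto
  then show "col_height n J (t k) = col_height n j (t k)"
    using eq(1) col_height_antimono[of j J n "t k"] J by simp
qed

context
  fixes n :: nat and t u :: "nat \<Rightarrow> nat \<Rightarrow> nat"
  assumes t: "interlacing n t" and u: "interlacing n u"
begin

text \<open>Each tableau contributes between -1 and 1 per column. Reaching 2 after column
  \<open>j\<close>, or dipping from 0 inside it, both mean that the follower has only
  \<open>Suc k\<close> and the leader exactly one of the two letters.\<close>

lemma bad_cases:
  assumes "bad n t u j k" "excess2 n t u (Suc j) k \<le> 0"
  shows "critical n t u j k \<or> excess2 n t u j k = 1"
  using assms col_height_step[OF t, of j k] col_height_step[OF t, of j "Suc k"]
    col_height_step[OF u, of j k] col_height_step[OF u, of j "Suc k"]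
  by (auto simp: bad_def critical_def mixed_def dips_def height_diff_def excess2_def
      excess_Suc[of n _ j] split: if_splits)

lemma critical_imp_bad: "critical n t u j k \<Longrightarrow> bad n t u j k"
  using col_height_step[OF t, of j k] col_height_step[OF t, of j "Suc k"]
    col_height_step[OF u, of j k] col_height_step[OF u, of j "Suc k"]
  by (auto simp: bad_def critical_def mixed_def dips_def height_diff_def excess2_def
      excess_Suc[of n _ j] split: if_splits)

text \<open>The follower at \<open>k\<close> has no \<open>k\<close> in column \<open>j\<close>, so
  the leader still leads at \<open>Suc k\<close>. Criticality there would forbid the letter
  \<open>Suc k\<close>, which the follower has.\<close>

lemma critical_not_adjacent: "critical n t u j k \<Longrightarrow> \<not> critical n t u j (Suc k)"
  using col_height_step[OF t, of j k] col_height_step[OF t, of j "Suc k"]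
    col_height_step[OF u, of j k] col_height_step[OF u, of j "Suc k"]
  by (auto simp: critical_def mixed_def height_diff_def split: if_splits)

text \<open>If column \<open>Suc j\<close> of the leader obstructed the toggle, then the same tableau would lead in that
  column and the pair would be bad there.\<close>

lemma leader_fits:
  assumes crit: "critical n t u j k" and good: "\<not> bad n t u (Suc j) k"
    and le: "excess2 n t u (Suc (Suc j)) k \<le> 0"
  shows "height_diff n t u j k > 0 \<Longrightarrow> fits (Suc j) k t"
    and "height_diff n t u j k \<le> 0 \<Longrightarrow> fits (Suc j) k u"
proof -
  note steps = col_height_step[OF t, of "Suc j" k] col_height_step[OF t, of "Suc j" "Suc k"]
    col_height_step[OF u, of "Suc j" k] col_height_step[OF u, of "Suc j" "Suc k"]
    col_height_antimono[of j "Suc j" n "t k"] col_height_antimono[of j "Suc j" n "u k"]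
  have 0: "excess2 n t u (Suc j) k = 0"
    using crit by (simp add: critical_def)
  {
    assume h: "height_diff n t u j k > 0"
    show "fits (Suc j) k t"
    proof (rule ccontr)
      assume "\<not> fits (Suc j) k t"
      \<comment> \<open>The obstruction makes the leader contribute -1 in column
        \<open>Suc j\<close>. As the count is 0 after that column and at most 0 before it, the
        follower contributes 1 and the count before is 0, which is a bad dip.\<close>
      from not_fits[OF t this] show False
        using good 0 le h steps
        by (auto simp: bad_def dips_def height_diff_def excess2_def excess_Suc[of n _ "Suc j"])
    qed
  next
    assume h: "height_diff n t u j k \<le> 0"
    show "fits (Suc j) k u"
    proof (rule ccontr)
      assume "\<not> fits (Suc j) k u"
      from not_fits[OF u this] show False
        using good 0 le h steps
        by (auto simp: bad_def dips_def height_diff_def excess2_def excess_Suc[of n _ "Suc j"])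
    qed
  }
qed

end

text \<open>In a critical position the leader is toggled in column \<open>j\<close> too, because its
  letter there is scanned after the violation. The follower, and in all other positions both
  tableaux, are toggled only left of \<open>j\<close>.\<close>

definition reach_left :: "nat \<Rightarrow> (nat \<Rightarrow> nat \<Rightarrow> nat) \<Rightarrow> (nat \<Rightarrow> nat \<Rightarrow> nat) \<Rightarrow> nat \<Rightarrow> nat \<Rightarrow> nat" where
  "reach_left n t u j k = (if critical n t u j k \<and> height_diff n t u j k > 0 then Suc j else j)"

definition reach_right :: "nat \<Rightarrow> (nat \<Rightarrow> nat \<Rightarrow> nat) \<Rightarrow> (nat \<Rightarrow> nat \<Rightarrow> nat) \<Rightarrow> nat \<Rightarrow> nat \<Rightarrow> nat" where
  "reach_right n t u j k = (if critical n t u j k \<and> height_diff n t u j k \<le> 0 then Suc j else j)"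

definition bad_col :: "nat \<Rightarrow> (nat \<Rightarrow> nat \<Rightarrow> nat) \<Rightarrow> (nat \<Rightarrow> nat \<Rightarrow> nat) \<Rightarrow> nat" where
  "bad_col n t u = (GREATEST j. \<exists>k. bad n t u j k)"

text \<open>Critical letters take precedence because a toggle that reaches into the column preserves
  which letters are critical there, but may change \<open>bad\<close> for the neighbours of the
  chosen letter. This way the second \<open>flip\<close> finds the same letter again.\<close>

definition bad_letter :: "nat \<Rightarrow> (nat \<Rightarrow> nat \<Rightarrow> nat) \<Rightarrow> (nat \<Rightarrow> nat \<Rightarrow> nat) \<Rightarrow> nat" where
  "bad_letter n t u = (if \<exists>k. critical n t u (bad_col n t u) k
     then LEAST k. critical n t u (bad_col n t u) k else LEAST k. bad n t u (bad_col n t u) k)"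

definition flip :: "nat \<Rightarrow> (nat \<Rightarrow> nat \<Rightarrow> nat) \<times> (nat \<Rightarrow> nat \<Rightarrow> nat)
    \<Rightarrow> (nat \<Rightarrow> nat \<Rightarrow> nat) \<times> (nat \<Rightarrow> nat \<Rightarrow> nat)" where
  "flip n = (\<lambda>(t, u). let j = bad_col n t u; k = bad_letter n t u in
     (toggle (reach_left n t u j k) k t, toggle (reach_right n t u j k) k u))"

lemma bad_cong:
  assumes "\<And>i. right_cells n j (t' i) = right_cells n j (t i)" "\<And>i. right_cells n j (u' i) = right_cells n j (u i)"
    "\<And>i. right_cells n (Suc j) (t' i) = right_cells n (Suc j) (t i)"
    "\<And>i. right_cells n (Suc j) (u' i) = right_cells n (Suc j) (u i)"
    "\<And>i. col_height n j (t' i) = col_height n j (t i)" "\<And>i. col_height n j (u' i) = col_height n j (u i)"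
  shows "bad n t' u' j k = bad n t u j k" "critical n t' u' j k = critical n t u j k"
  by (simp_all add: bad_def critical_def dips_def mixed_def height_diff_def excess2_def excess_def assms)

lemma flip_step:
  assumes t: "interlacing n t" and u: "interlacing n u"
    and last: "\<And>i k'. j < i \<Longrightarrow> \<not> bad n t u i k'"
    and bad: "bad n t u j k"
    and sel: "critical n t u j k \<or> (\<forall>k'. \<not> critical n t u j k')"
  defines "Jt \<equiv> reach_left n t u j k" and "Ju \<equiv> reach_right n t u j k"
  defines "t' \<equiv> toggle Jt k t" and "u' \<equiv> toggle Ju k u"
  shows "fits Jt k t" "fits Ju k u"
    and "excess n t Jt k + excess n u Ju k = 1"
    and "\<And>i k'. j < i \<Longrightarrow> \<not> bad n t' u' i k'"
    and "\<And>k'. critical n t' u' j k' = critical n t u j k'"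
    and "(\<forall>k'. \<not> critical n t u j k') \<Longrightarrow> bad n t' u' j k' = bad n t u j k'"
    and "height_diff n t' u' j k = height_diff n t u j k"
proof -
  have le: "excess2 n t u i k' \<le> 0" if "j < i" for i k'
    using last[OF that, of k'] by (simp add: bad_def)
  have fits: "fits Jt k t \<and> fits Ju k u \<and> excess n t Jt k + excess n u Ju k = 1"
  proof (cases "critical n t u j k")
    case True
    note lf = leader_fits[OF t u True last[of "Suc j" k] le[of "Suc (Suc j)" k]]
    show ?thesis
    proof (cases "height_diff n t u j k > 0")
      case h: True
      then have m: "mixed n t u j k" and J: "Jt = Suc j" "Ju = j"
        using True by (auto simp: critical_def Jt_def Ju_def reach_left_def reach_right_def)
      \<comment> \<open>The follower has no \<open>k\<close> in column \<open>j\<close>, while an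
        obstruction would need one there.\<close>
      have "fits j k u"
        using not_fits(1,2)[OF u, of j k] m by (auto simp: mixed_def)
      then show ?thesis
        using lf(1)[OF _ _ h] True m unfolding J
        by (simp add: critical_def excess2_def mixed_def excess_Suc[of n u j])
    next
      case h: False
      then have m: "mixed n u t j k" and J: "Jt = j" "Ju = Suc j"
        using True by (auto simp: critical_def Jt_def Ju_def reach_left_def reach_right_def)
      have "fits j k t"
        using not_fits(1,2)[OF t, of j k] m by (auto simp: mixed_def)
      then show ?thesis
        using lf(2) h True m unfolding J
        by (simp add: critical_def excess2_def mixed_def excess_Suc[of n t j])
    qed
  next
    case False
    then have J: "Jt = j" "Ju = j"
      by (auto simp: Jt_def Ju_def reach_left_def reach_right_def)
    have E: "excess2 n t u j k = 1" "excess2 n t u (Suc j) k \<le> 0"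
      using bad_cases[OF t u bad] le[of "Suc j" k] False by auto
    note steps = col_height_step[OF t, of j k] col_height_step[OF t, of j "Suc k"]
      col_height_step[OF u, of j k] col_height_step[OF u, of j "Suc k"]
    \<comment> \<open>An obstruction would contribute -1 in column \<open>j\<close> and keep the
      count at 0 or below.\<close>
    have "fits j k t"
      using not_fits(1,2)[OF t, of j k] E steps
      by (fastforce simp: excess2_def excess_Suc[of n _ j])
    moreover have "fits j k u"
      using not_fits(1,2)[OF u, of j k] E steps
      by (fastforce simp: excess2_def excess_Suc[of n _ j])
    ultimately show ?thesis
      using E unfolding J by (simp add: excess2_def)
  qed
  then show fits': "fits Jt k t" "fits Ju k u" and "excess n t Jt k + excess n u Ju k = 1"
    by auto
  have Jle: "Jt \<le> Suc j" "Ju \<le> Suc j"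
    by (auto simp: Jt_def Ju_def reach_left_def reach_right_def)
  note rt = toggle_right[OF t fits'(1), folded t'_def] and ru = toggle_right[OF u fits'(2), folded u'_def]
  have right: "right_cells n i (t' l) = right_cells n i (t l)" "right_cells n i (u' l) = right_cells n i (u l)"
    "col_height n i (t' l) = col_height n i (t l)" "col_height n i (u' l) = col_height n i (u l)"
    if "j < i" for i l
    using rt[of i l] ru[of i l] that Jle by auto
  show "\<not> bad n t' u' i k'" if "j < i" for i k'
    using last[OF that, of k'] bad_cong(1)[of n i t' t u' u k'] right that by auto
  show "height_diff n t' u' j k = height_diff n t u j k"
    by (simp add: height_diff_def t'_def u'_def toggle_other)
  show noncrit: "bad n t' u' j k' = bad n t u j k'" if "\<forall>k'. \<not> critical n t u j k'" for k'
  proof -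
    have "Jt = j" "Ju = j"
      using that by (auto simp: Jt_def Ju_def reach_left_def reach_right_def)
    then show ?thesis
      using bad_cong(1)[of n j t' t u' u k'] right rt[of j] ru[of j] by simp
  qed
  show "critical n t' u' j k' = critical n t u j k'" for k'
  proof (cases "critical n t u j k")
    case False
    then have "Jt = j" "Ju = j"
      by (auto simp: Jt_def Ju_def reach_left_def reach_right_def)
    then show ?thesis
      using bad_cong(2)[of n j t' t u' u k'] right rt[of j] ru[of j] by simp
  next
    case True
    have it: "interlacing n t'" "interlacing n u'"
      unfolding t'_def u'_def using interlacing_toggle[OF t fits'(1)] interlacing_toggle[OF u fits'(2)] by auto
    have E: "excess2 n t' u' (Suc j) l = excess2 n t u (Suc j) l" for l
      using right[of "Suc j"] by (simp add: excess2_def excess_def)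
    have other: "t' i = t i" "u' i = u i" if "i \<noteq> Suc k" for i
      using that by (simp_all add: t'_def u'_def toggle_other)
    \<comment> \<open>\<open>mixed\<close> reads the leader only at levels \<open>k\<close> and
      \<open>Suc (Suc k)\<close>, which the toggle leaves alone, and the follower only in column
      \<open>j\<close>, which lies outside its reach.\<close>
    have crit_k: "critical n t' u' j k"
    proof (cases "height_diff n t u j k > 0")
      case h: True
      then have "Ju = j" by (simp add: Ju_def reach_right_def)
      then show ?thesis
        using True h ru(2)[of j] E[of k] other[of k] other[of "Suc (Suc k)"]
        by (simp add: critical_def mixed_def height_diff_def)
    next
      case h: False
      then have "Jt = j" by (simp add: Jt_def reach_left_def)
      then show ?thesis
        using True h rt(2)[of j] E[of k] other[of k] other[of "Suc (Suc k)"]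
        by (simp add: critical_def mixed_def height_diff_def)
    qed
    \<comment> \<open>The neighbours of \<open>k\<close> do see the changed level, but they are
      critical neither before nor after the toggle.\<close>
    consider "k' = k" | "k' = Suc k" | "Suc k' = k" | "k' \<noteq> k" "k' \<noteq> Suc k" "Suc k' \<noteq> k" by blast
    then show ?thesis
    proof cases
      case 1
      then show ?thesis using crit_k True by simp
    next
      case 2
      then show ?thesis
        using critical_not_adjacent[OF t u True] critical_not_adjacent[OF it crit_k] by simp
    next
      case 3
      then show ?thesis
        using critical_not_adjacent[OF t u, of j k'] critical_not_adjacent[OF it, of j k'] True crit_k by auto
    next
      case 4
      then show ?thesis
        using E[of k'] other[of k'] other[of "Suc k'"] other[of "Suc (Suc k')"]
        by (simp add: critical_def mixed_def height_diff_def)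
    qed
  qed
qed

section \<open>Chains with prescribed ends, and the cancelling involution on them\<close>

definition chains :: "nat \<Rightarrow> (nat \<Rightarrow> nat) \<Rightarrow> (nat \<Rightarrow> nat) \<Rightarrow> nat \<Rightarrow> (nat \<Rightarrow> nat \<Rightarrow> nat) set" where
  "chains n lam \<mu> N = {t. interlacing n t \<and> t 0 = \<mu> \<and> (\<forall>k\<ge>N. t k = lam)}"

lemma chainsD:
  assumes "t \<in> chains n lam \<mu> N"
  shows "interlacing n t" "t 0 = \<mu>" "N \<le> k \<Longrightarrow> t k = lam"
  using assms by (auto simp: chains_def)

lemma chainsI:
  "interlacing n t \<Longrightarrow> t 0 = \<mu> \<Longrightarrow> (\<And>k. N \<le> k \<Longrightarrow> t k = lam) \<Longrightarrow> t \<in> chains n lam \<mu> N"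
  by (simp add: chains_def)

lemma chains_le:
  assumes "t \<in> chains n lam \<mu> N"
  shows "t k r \<le> lam 0"
proof -
  have "t k r \<le> t (max k N) r" "t (max k N) r \<le> t (max k N) 0"
    using assms interlacing_mono[of n t k "max k N"] interlacing_antimono[of n t 0 r]
    by (auto simp: chains_def)
  then show ?thesis using assms by (auto simp: chains_def)
qed

lemma finite_chains: "finite (chains n lam \<mu> N)"
proof -
  let ?D = "{..<N} \<times> {..<n}"
  let ?f = "\<lambda>t. restrict (case_prod t) ?D :: nat \<times> nat \<Rightarrow> nat"
  have "inj_on ?f (chains n lam \<mu> N)"
  proof (rule inj_onI)
    fix t u assume t: "t \<in> chains n lam \<mu> N" and u: "u \<in> chains n lam \<mu> N" and eq: "?f t = ?f u"
    have "t k r = u k r" for k r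
    proof (cases "k < N \<and> r < n")
      case True
      then show ?thesis using fun_cong[OF eq, of "(k, r)"] by simp
    next
      case False
      then show ?thesis using t u by (auto simp: chains_def interlacing_def not_less)
    qed
    then show "t = u" by (intro ext)
  qed
  moreover have "?f ` chains n lam \<mu> N \<subseteq> ?D \<rightarrow>\<^sub>E {..lam 0}"
    using chains_le by (auto simp: PiE_def extensional_def)
  moreover have "finite (?D \<rightarrow>\<^sub>E {..lam 0})"
    by (intro finite_PiE) auto
  ultimately show ?thesis
    by (meson finite_imageD finite_subset)
qed

lemma toggle_chains:
  assumes "t \<in> chains n lam \<mu> N" "fits J k t" "Suc k < N"
  shows "toggle J k t \<in> chains n lam \<mu> N"
  using assms interlacing_toggle[of n t J k] by (auto simp: chains_def toggle_other)

lemma bad_bound: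
  assumes t: "t \<in> chains n lam \<mu> N" and u: "u \<in> chains n \<nu> \<rho> N" and bad: "bad n t u j k"
  shows "j < max (lam 0) (\<nu> 0)" "Suc k < N"
proof -
  show "j < max (lam 0) (\<nu> 0)"
  proof (rule ccontr)
    assume "\<not> j < max (lam 0) (\<nu> 0)"
    then have "t i r \<le> j" "u i r \<le> j" for i r
      using chains_le[OF t, of i r] chains_le[OF u, of i r] by auto
    then have "right_cells n j (t i) = 0" "right_cells n j (u i) = 0"
      "col_height n j (t i) = 0" "col_height n j (u i) = 0" for i
      by (simp_all add: right_cells_def col_height_def not_less)
    then show False
      using bad by (simp add: bad_def dips_def height_diff_def excess2_def excess_def)
  qed
  show "Suc k < N"
  proof (rule ccontr)
    assume "\<not> Suc k < N"
    then have eq: "t (Suc (Suc k)) = t (Suc k)" "u (Suc (Suc k)) = u (Suc k)"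
      using t u by (auto simp: chains_def)
    have "right_cells n j (x k) \<le> right_cells n j (x (Suc k))" if "interlacing n x" for x
      unfolding right_cells_def by (intro sum_mono) (use interlacingD(1)[OF that] in \<open>simp add: diff_le_mono\<close>)
    from this[of t] this[of u] show False
      using bad t u eq
      by (auto simp: bad_def dips_def height_diff_def excess2_def excess_def chains_def split: if_splits)
  qed
qed

text \<open>For \<open>e = 1\<close> this swaps two entries of the weight after subtracting
  \<open>i\<close> from entry \<open>i\<close>, the operation under which \<open>alternant\<close>
  changes sign. For \<open>e = 0\<close> it is the plain transposition, which yields the symmetry of
  the series.\<close>

lemma weight_toggle:
  assumes "interlacing n t" "interlacing n u" "fits J k t" "fits J' k u"
    and "excess n t J k + excess n u J' k = e"
  shows "weight n (toggle J k t) (toggle J' k u) k = weight n t u (Suc k) - e"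
    and "weight n (toggle J k t) (toggle J' k u) (Suc k) = weight n t u k + e"
    and "i \<noteq> k \<Longrightarrow> i \<noteq> Suc k \<Longrightarrow> weight n (toggle J k t) (toggle J' k u) i = weight n t u i"
  using right_cells_toggle[OF assms(1,3)] right_cells_toggle[OF assms(2,4)] assms(5)
  by (auto simp: weight_def toggle_other excess_def)

lemma flip_properties:
  assumes t: "t \<in> chains n lam \<mu> N" and u: "u \<in> chains n \<nu> \<rho> N"
    and nonyam: "\<not> yamanouchi n t u" and f: "flip n (t, u) = (t', u')"
  defines "k \<equiv> bad_letter n t u"
  shows "t' \<in> chains n lam \<mu> N" "u' \<in> chains n \<nu> \<rho> N" "\<not> yamanouchi n t' u'"
    and "flip n (t', u') = (t, u)" and "Suc k < N"
    and "weight n t' u' k = weight n t u (Suc k) - 1" "weight n t' u' (Suc k) = weight n t u k + 1"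
    and "\<And>i. i \<noteq> k \<Longrightarrow> i \<noteq> Suc k \<Longrightarrow> weight n t' u' i = weight n t u i"
proof -
  define j where "j = bad_col n t u"
  let ?P = "\<lambda>j. \<exists>k. bad n t u j k"
  let ?b = "max (lam 0) (\<nu> 0)"
  have it: "interlacing n t" and iu: "interlacing n u"
    using t u by (auto simp: chains_def)
  have b: "?P i \<Longrightarrow> i \<le> ?b" for i
    using bad_bound(1)[OF t u] less_imp_le by blast
  obtain i where "?P i"
    using nonyam by (auto simp: yamanouchi_def)
  then have Pj: "?P j" and last: "\<And>i k'. j < i \<Longrightarrow> \<not> bad n t u i k'"
    unfolding j_def bad_col_def using GreatestI_nat[of ?P i ?b] Greatest_le_nat[of ?P _ ?b] b
    by (blast, metis not_less)
  have k_crit: "critical n t u j k" if "\<exists>k. critical n t u j k"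
    using LeastI_ex[OF that] that by (simp add: k_def bad_letter_def j_def)
  have k_noncrit: "bad n t u j k" if "\<not> (\<exists>k. critical n t u j k)"
    using LeastI_ex[OF Pj] that by (simp add: k_def bad_letter_def j_def)
  have bad: "bad n t u j k"
    using k_crit k_noncrit critical_imp_bad[OF it iu] by blast
  have sel: "critical n t u j k \<or> (\<forall>k'. \<not> critical n t u j k')"
    using k_crit by blast
  note step = flip_step[OF it iu last bad sel]
  have t': "t' = toggle (reach_left n t u j k) k t" and u': "u' = toggle (reach_right n t u j k) k u"
    using f by (auto simp: flip_def Let_def j_def k_def)
  note step' = step[folded t' u']
  show kN: "Suc k < N"
    using bad_bound(2)[OF t u bad] .
  show "t' \<in> chains n lam \<mu> N" "u' \<in> chains n \<nu> \<rho> N"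
    unfolding t' u' using toggle_chains[OF t step(1) kN] toggle_chains[OF u step(2) kN] by auto
  have it': "interlacing n t'" and iu': "interlacing n u'"
    unfolding t' u' using interlacing_toggle[OF it step(1)] interlacing_toggle[OF iu step(2)] by auto
  have bad': "bad n t' u' j k"
    using critical_imp_bad[OF it' iu', of j k] step'(5)[of k] step'(6)[of k] sel bad by blast
  then show "\<not> yamanouchi n t' u'"
    by (auto simp: yamanouchi_def)
  have j': "bad_col n t' u' = j"
    unfolding bad_col_def using bad' step'(4) by (intro Greatest_equality) (auto simp: not_less[symmetric])
  have "critical n t' u' j = critical n t u j"
    using step'(5) by blast
  moreover have "bad n t' u' j = bad n t u j" if "\<nexists>k'. critical n t u j k'"
    using step'(6) that by blast
  ultimately have k': "bad_letter n t' u' = k"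
    unfolding bad_letter_def j' k_def j_def[symmetric] by auto
  have "reach_left n t' u' j k = reach_left n t u j k" "reach_right n t' u' j k = reach_right n t u j k"
    by (simp_all add: reach_left_def reach_right_def step'(5,7))
  then show "flip n (t', u') = (t, u)"
    unfolding flip_def Let_def prod.case j' k'
    unfolding t' u' using toggle_toggle[OF it step(1)] toggle_toggle[OF iu step(2)] by simp
  show "weight n t' u' k = weight n t u (Suc k) - 1" "weight n t' u' (Suc k) = weight n t u k + 1"
    and "\<And>i. i \<noteq> k \<Longrightarrow> i \<noteq> Suc k \<Longrightarrow> weight n t' u' i = weight n t u i"
    unfolding t' u' using weight_toggle[OF it iu step(1,2,3)] by auto
qed

section \<open>Signed coefficient extraction\<close>

text \<open>For a symmetric series \<open>F\<close>, the sum of \<open>F \<alpha> * alternant N \<kappa> \<alpha>\<close> over all \<open>\<alpha>\<close> is the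
  coefficient of \<open>x ^ (\<kappa> + \<delta>)\<close> in the product of \<open>F\<close> with the Vandermonde determinant of \<open>N\<close>
  variables, where \<open>\<delta> = (N, N - 1, \<dots>, 1)\<close>.\<close>

definition alternant :: "nat \<Rightarrow> (nat \<Rightarrow> int) \<Rightarrow> (nat \<Rightarrow> int) \<Rightarrow> int" where
  "alternant N \<kappa> \<alpha> = (\<Sum>p | p permutes {..<N}.
     sign p * of_bool (\<forall>i<N. \<alpha> (p i) - int (p i) = \<kappa> i - int i))"

text \<open>The assumptions say that the sequence \<open>\<alpha> i - i\<close> gets its entries
  \<open>k\<close> and \<open>Suc k\<close> swapped; composing every permutation with this
  transposition reverses all signs.\<close>

lemma alternant_dot:
  assumes "Suc k < N" "\<alpha>' k = \<alpha> (Suc k) - 1" "\<alpha>' (Suc k) = \<alpha> k + 1"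
    "\<And>i. i \<noteq> k \<Longrightarrow> i \<noteq> Suc k \<Longrightarrow> \<alpha>' i = \<alpha> i"
  shows "alternant N \<kappa> \<alpha>' = - alternant N \<kappa> \<alpha>"
proof -
  let ?s = "transpose k (Suc k)"
  have s: "?s permutes {..<N}"
    using assms(1) by (intro permutes_swap_id) auto
  have eq: "\<alpha>' (?s i) - int (?s i) = \<alpha> i - int i" for i
    using assms by (auto simp: transpose_def)
  have "alternant N \<kappa> \<alpha>' = (\<Sum>p | p permutes {..<N}.
     sign (?s \<circ> p) * of_bool (\<forall>i<N. \<alpha>' ((?s \<circ> p) i) - int ((?s \<circ> p) i) = \<kappa> i - int i))"
    unfolding alternant_def by (rule setum_permutations_compose_left[OF s])
  also have "\<dots> = (\<Sum>p | p permutes {..<N}.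
     - (sign p * of_bool (\<forall>i<N. \<alpha> (p i) - int (p i) = \<kappa> i - int i)))"
  proof (rule sum.cong)
    fix p assume "p \<in> {p. p permutes {..<N}}"
    then have "sign (?s \<circ> p) = - sign p"
      by (subst sign_compose)
        (auto simp: sign_swap_id permutation_swap_id intro: permutes_imp_permutation[of "{..<N}"])
    then show "sign (?s \<circ> p) * of_bool (\<forall>i<N. \<alpha>' ((?s \<circ> p) i) - int ((?s \<circ> p) i) = \<kappa> i - int i)
      = - (sign p * of_bool (\<forall>i<N. \<alpha> (p i) - int (p i) = \<kappa> i - int i))"
      by (simp add: eq)
  qed simp
  finally show ?thesis by (simp add: alternant_def sum_negf)
qed

text \<open>Subtracting \<open>i\<close> makes both sequences strictly decreasing, so only the
  identity permutation can match them.\<close>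

lemma alternant_dominant:
  assumes \<alpha>: "\<And>i. Suc i < N \<Longrightarrow> \<alpha> (Suc i) \<le> \<alpha> i" and \<kappa>: "\<And>i. Suc i < N \<Longrightarrow> \<kappa> (Suc i) \<le> \<kappa> i"
  shows "alternant N \<kappa> \<alpha> = of_bool (\<forall>i<N. \<alpha> i = \<kappa> i)"
proof -
  have strict: "f j - int j < f i - int i"
    if "i < j" "j < N" "\<And>i. Suc i < N \<Longrightarrow> f (Suc i) \<le> f i" for f :: "nat \<Rightarrow> int" and i j
    using that(1,2)
  proof (induction rule: strict_inc_induct)
    case (base i)
    then show ?case using that(3)[of i] by simp
  next
    case (step i)
    then show ?case using that(3)[of i] by simp
  qed
  have "p = id" if p: "p permutes {..<N}" and eq: "\<forall>i<N. \<alpha> (p i) - int (p i) = \<kappa> i - int i" for p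
  proof -
    have mono: "p i < p j" if ij: "i < j" "j < N" for i j
    proof -
      have N: "p i < N" "p j < N"
        using p ij permutes_in_image[OF p] by auto
      have "\<kappa> j - int j < \<kappa> i - int i"
        using strict[OF ij, of \<kappa>] \<kappa> by blast
      then have "\<alpha> (p j) - int (p j) < \<alpha> (p i) - int (p i)"
        using eq ij by auto
      then show ?thesis
        using strict[of "p j" "p i" \<alpha>] \<alpha> N by (metis linorder_neqE_nat order.asym)
    qed
    have "i \<le> p i" if "i < N" for i
      using that
    proof (induction i)
      case (Suc i)
      then show ?case using mono[of i "Suc i"] by simp
    qed simp
    then show ?thesis
      using permutes_natset_ge[OF p] by auto
  qed
  then have "alternant N \<kappa> \<alpha> = (\<Sum>p | p permutes {..<N}. if p = id then of_bool (\<forall>i<N. \<alpha> i = \<kappa> i) else 0)"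
    unfolding alternant_def by (intro sum.cong) auto
  also have "\<dots> = of_bool (\<forall>i<N. \<alpha> i = \<kappa> i)"
    by (simp add: finite_permutations permutes_id)
  finally show ?thesis .
qed

lemma weight_nonneg:
  assumes "interlacing n t" "interlacing n u"
  shows "0 \<le> weight n t u k"
proof -
  have "right_cells n 0 (x k) \<le> right_cells n 0 (x (Suc k))" if "interlacing n x" for x
    unfolding right_cells_def by (intro sum_mono) (use interlacingD(1)[OF that] in simp)
  from this[of t] this[of u] show ?thesis
    using assms by (simp add: weight_def)
qed

lemma yamanouchi_weight_antimono:
  assumes "yamanouchi n t u"
  shows "weight n t u (Suc k) \<le> weight n t u k"
proof -
  have "\<not> bad n t u 0 k"
    using assms by (simp add: yamanouchi_def)
  then show ?thesis
    using excess2_0[of n t u k] by (simp add: bad_def)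
qed

text \<open>\<open>flip\<close> pairs off the non-Yamanouchi terms with opposite signs. The
  remaining weights are dominant, where \<open>alternant\<close> is an indicator.\<close>

lemma sum_alternant_weight:
  fixes n N :: nat and lam \<mu> \<nu> \<rho> :: "nat \<Rightarrow> nat"
  assumes \<kappa>: "\<And>i. Suc i < N \<Longrightarrow> \<kappa> (Suc i) \<le> \<kappa> i"
  defines "Z \<equiv> chains n lam \<mu> N \<times> chains n \<nu> \<rho> N"
  shows "(\<Sum>(t, u)\<in>Z. alternant N \<kappa> (weight n t u))
    = int (card {(t, u) \<in> Z. yamanouchi n t u \<and> (\<forall>i<N. weight n t u i = \<kappa> i)})"
proof -
  let ?Y = "{(t, u) \<in> Z. yamanouchi n t u}" and ?B = "{(t, u) \<in> Z. \<not> yamanouchi n t u}"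
  let ?a = "\<lambda>(t, u). alternant N \<kappa> (weight n t u)"
  have fin: "finite Z"
    by (simp add: Z_def finite_chains)
  have flip: "flip n z \<in> ?B" "flip n (flip n z) = z" "?a (flip n z) = - ?a z" if z: "z \<in> ?B" for z
  proof -
    obtain t u t' u' where tu: "z = (t, u)" "flip n z = (t', u')"
      by (metis surj_pair)
    have "t \<in> chains n lam \<mu> N" "u \<in> chains n \<nu> \<rho> N" "\<not> yamanouchi n t u" "flip n (t, u) = (t', u')"
      using z tu by (auto simp: Z_def)
    note props = flip_properties[OF this]
    show "flip n z \<in> ?B" "flip n (flip n z) = z"
      using props(1-4) tu by (auto simp: Z_def)
    show "?a (flip n z) = - ?a z"
      using alternant_dot[OF props(5-8)] tu by simp
  qed
  have "sum ?a ?B = sum (?a \<circ> flip n) ?B"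
    by (rule sum.reindex_bij_witness[of _ "flip n" "flip n"]) (use flip in auto)
  also have "\<dots> = - sum ?a ?B"
    unfolding sum_negf[symmetric] by (rule sum.cong) (use flip(3) in auto)
  finally have B: "sum ?a ?B = 0" by simp
  have "sum ?a Z = sum ?a ?Y + sum ?a ?B"
    by (subst sum.union_disjoint[symmetric]) (use fin in \<open>auto intro!: sum.cong intro: finite_subset[OF _ fin]\<close>)
  also have "sum ?a ?Y = (\<Sum>(t, u)\<in>?Y. of_bool (\<forall>i<N. weight n t u i = \<kappa> i))"
    by (rule sum.cong) (use \<kappa> yamanouchi_weight_antimono in \<open>auto simp: alternant_dominant\<close>)
  also have "\<dots> = int (card {(t, u) \<in> Z. yamanouchi n t u \<and> (\<forall>i<N. weight n t u i = \<kappa> i)})"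
  proof -
    have "finite ?Y" using fin by (rule rev_finite_subset) auto
    moreover have "?Y \<inter> {z. case z of (t, u) \<Rightarrow> \<forall>i<N. weight n t u i = \<kappa> i}
      = {(t, u) \<in> Z. yamanouchi n t u \<and> (\<forall>i<N. weight n t u i = \<kappa> i)}" by auto
    ultimately show ?thesis
      by (simp add: case_prod_unfold of_bool_def sum.If_cases)
  qed
  finally show ?thesis using B by simp
qed

text \<open>If \<open>f\<close> were nonzero, take \<open>\<kappa>\<close> in its support maximising the sum of the
  \<open>(\<kappa> i - i)\<^sup>2\<close>. All maximisers
  are dominant by symmetry, so \<open>\<kappa>\<close> contributes the only nonzero term to the sum with
  \<open>alternant N \<kappa>\<close>.\<close>

lemma symmetric_eq_zero:
  fixes f :: "(nat \<Rightarrow> int) \<Rightarrow> int"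
  assumes A: "finite A" "\<And>\<alpha>. f \<alpha> \<noteq> 0 \<Longrightarrow> \<alpha> \<in> A" "\<And>\<alpha> i. \<alpha> \<in> A \<Longrightarrow> N \<le> i \<Longrightarrow> \<alpha> i = 0"
    and sym: "\<And>\<alpha> k. Suc k < N \<Longrightarrow> f (\<alpha> \<circ> transpose k (Suc k)) = f \<alpha>"
    and zero: "\<And>\<kappa>. \<kappa> \<in> A \<Longrightarrow> (\<And>i. Suc i < N \<Longrightarrow> \<kappa> (Suc i) \<le> \<kappa> i) \<Longrightarrow> (\<Sum>\<alpha>\<in>A. f \<alpha> * alternant N \<kappa> \<alpha>) = 0"
  shows "f \<alpha> = 0"
proof (rule ccontr)
  define S where "S = {\<alpha>. f \<alpha> \<noteq> 0}"
  define q where "q \<alpha> = (\<Sum>i<N. (\<alpha> i - int i)\<^sup>2)" for \<alpha> :: "nat \<Rightarrow> int"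
  assume "f \<alpha> \<noteq> 0"
  then have S: "finite S" "S \<noteq> {}" "S \<subseteq> A"
    using A(1,2) by (auto simp: S_def intro: finite_subset[of _ A])
  then have "Max (q ` S) \<in> q ` S" by (intro Max_in) auto
  then obtain \<kappa> where \<kappa>: "\<kappa> \<in> S" "q \<kappa> = Max (q ` S)" by auto
  have max: "q \<beta> \<le> q \<kappa>" if "\<beta> \<in> S" for \<beta>
    using that S(1) unfolding \<kappa>(2) by simp
  have sorted: "\<beta> (Suc k) \<le> \<beta> k" if \<beta>: "\<beta> \<in> S" "q \<beta> = q \<kappa>" and k: "Suc k < N" for \<beta> k
  proof (rule ccontr)
    assume less: "\<not> \<beta> (Suc k) \<le> \<beta> k"
    let ?\<beta> = "\<beta> \<circ> transpose k (Suc k)"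
    have "q ?\<beta> - q \<beta> = (\<Sum>i<N. (?\<beta> i - int i)\<^sup>2 - (\<beta> i - int i)\<^sup>2)"
      by (simp add: q_def sum_subtractf)
    also have "\<dots> = (\<Sum>i\<in>{k, Suc k}. (?\<beta> i - int i)\<^sup>2 - (\<beta> i - int i)\<^sup>2)"
      using k by (intro sum.mono_neutral_right) (auto simp: transpose_def)
    also have "\<dots> = 2 * (\<beta> (Suc k) - \<beta> k)"
      by (simp add: power2_eq_square algebra_simps)
    finally have "q \<kappa> < q ?\<beta>" using less \<beta>(2) by simp
    moreover have "?\<beta> \<in> S" using \<beta>(1) sym[OF k] by (simp add: S_def)
    ultimately show False using max by force
  qed
  have "f \<beta> * alternant N \<kappa> \<beta> = (if \<beta> = \<kappa> then f \<kappa> else 0)" if \<beta>: "\<beta> \<in> A" for \<beta>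
  proof (cases "f \<beta> * alternant N \<kappa> \<beta> = 0 \<and> \<beta> \<noteq> \<kappa>")
    case False
    \<comment> \<open>A nonzero \<open>alternant\<close> makes the shifted entries of
      \<open>\<beta>\<close> a rearrangement of those of \<open>\<kappa>\<close>. So
      \<open>\<beta>\<close> is a maximiser as well, hence dominant.\<close>
    have "q \<beta> = q \<kappa>" if nz: "f \<beta> * alternant N \<kappa> \<beta> \<noteq> 0"
    proof -
      obtain p where p: "p permutes {..<N}" "\<forall>i<N. \<beta> (p i) - int (p i) = \<kappa> i - int i"
        using nz unfolding alternant_def by (auto elim!: sum.not_neutral_contains_not_neutral split: if_splits)
      have "q \<beta> = (\<Sum>i<N. (\<beta> (p i) - int (p i))\<^sup>2)"
        unfolding q_def by (rule sum.permute[OF p(1), unfolded o_def])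
      also have "\<dots> = q \<kappa>" unfolding q_def by (rule sum.cong) (use p(2) in auto)
      finally show ?thesis .
    qed
    then have "\<beta> \<in> S" "q \<beta> = q \<kappa>"
      using False \<kappa>(1) by (auto simp: S_def)
    then have "alternant N \<kappa> \<beta> = of_bool (\<forall>i<N. \<beta> i = \<kappa> i)"
      using sorted \<kappa>(1) by (intro alternant_dominant) auto
    moreover have "(\<forall>i<N. \<beta> i = \<kappa> i) \<longleftrightarrow> \<beta> = \<kappa>"
      using A(3)[OF \<beta>] A(3)[of \<kappa>] \<kappa>(1) S(3) by (metis ext not_less subsetD)
    ultimately show ?thesis by simp
  qed auto
  then have "(\<Sum>\<beta>\<in>A. f \<beta> * alternant N \<kappa> \<beta>) = f \<kappa>"
    using A(1) \<kappa>(1) S(3) by (auto simp: sum.delta')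
  moreover have "(\<Sum>\<beta>\<in>A. f \<beta> * alternant N \<kappa> \<beta>) = 0"
    using sorted \<kappa>(1) S(3) by (intro zero) auto
  ultimately show False using \<kappa>(1) by (simp add: S_def)
qed

section \<open>The Littlewood--Richardson rule for pairs\<close>

definition num_pairs :: "nat \<Rightarrow> (nat \<Rightarrow> nat) \<Rightarrow> (nat \<Rightarrow> nat) \<Rightarrow> (nat \<Rightarrow> nat) \<Rightarrow> (nat \<Rightarrow> nat) \<Rightarrow> nat \<Rightarrow> (nat \<Rightarrow> int) \<Rightarrow> int" where
  "num_pairs n lam \<mu> \<nu> \<rho> N \<alpha>
     = int (card {(t, u) \<in> chains n lam \<mu> N \<times> chains n \<nu> \<rho> N. weight n t u = \<alpha>})"

lemma weight_eq_0:
  assumes "t \<in> chains n lam \<mu> N" "u \<in> chains n \<nu> \<rho> N" "N \<le> i"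
  shows "weight n t u i = 0"
  using assms by (simp add: chains_def weight_def)

text \<open>With \<open>J\<close> beyond all columns nothing is cut off: these are the full
  Bender--Knuth involutions, and the excess at \<open>J\<close> is 0.\<close>

lemma num_pairs_symmetric:
  assumes k: "Suc k < N"
  shows "num_pairs n lam \<mu> \<nu> \<rho> N (\<alpha> \<circ> transpose k (Suc k)) = num_pairs n lam \<mu> \<nu> \<rho> N \<alpha>"
proof -
  define J where "J = max (lam 0) (\<nu> 0)"
  let ?Z = "\<lambda>\<alpha>. {(t, u) \<in> chains n lam \<mu> N \<times> chains n \<nu> \<rho> N. weight n t u = \<alpha>}"
  let ?f = "\<lambda>(t, u). (toggle J k t, toggle J k u)"
  have fits: "fits J k x \<and> excess n x J k = 0" if "x \<in> chains n lam' \<mu>' N" "lam' 0 \<le> J" for x lam' \<mu>'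
  proof -
    have "x i r \<le> J" for i r
      using chains_le[OF that(1), of i r] that(2) by simp
    then show ?thesis
      by (simp add: fits_def excess_def right_cells_def)
  qed
  have f: "?f z \<in> ?Z (\<beta> \<circ> transpose k (Suc k)) \<and> ?f (?f z) = z" if "z \<in> ?Z \<beta>" for z \<beta>
  proof -
    obtain t u where z: "z = (t, u)" and t: "t \<in> chains n lam \<mu> N" and u: "u \<in> chains n \<nu> \<rho> N"
      and w: "weight n t u = \<beta>" using \<open>z \<in> ?Z \<beta>\<close> by auto
    have i: "interlacing n t" "interlacing n u" using t u by (auto simp: chains_def)
    have ft: "fits J k t" "excess n t J k = 0" using fits[OF t] by (auto simp: J_def)
    have fu: "fits J k u" "excess n u J k = 0" using fits[OF u] by (auto simp: J_def)
    have "excess n t J k + excess n u J k = 0" using ft(2) fu(2) by simp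
    note wt = weight_toggle[OF i ft(1) fu(1) this]
    have "weight n (toggle J k t) (toggle J k u) = \<beta> \<circ> transpose k (Suc k)"
      using wt w by (auto simp: fun_eq_iff transpose_def)
    then show ?thesis
      using toggle_chains[OF t ft(1) k] toggle_chains[OF u fu(1) k]
        toggle_toggle[OF i(1) ft(1)] toggle_toggle[OF i(2) fu(1)] z by simp
  qed
  have "bij_betw ?f (?Z \<alpha>) (?Z (\<alpha> \<circ> transpose k (Suc k)))"
    by (rule bij_betw_byWitness[where f' = ?f])
      (use f[of _ \<alpha>] f[of _ "\<alpha> \<circ> transpose k (Suc k)"] in \<open>auto simp: comp_assoc\<close>)
  from bij_betw_same_card[OF this] show ?thesis
    unfolding num_pairs_def by (simp only:)
qed

lemma sum_num_pairs_alternant: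
  assumes A: "finite A" "\<And>t u. t \<in> chains n lam \<mu> N \<Longrightarrow> u \<in> chains n \<nu> \<rho> N \<Longrightarrow> weight n t u \<in> A"
    and \<kappa>: "\<And>i. Suc i < N \<Longrightarrow> \<kappa> (Suc i) \<le> \<kappa> i"
  shows "(\<Sum>\<alpha>\<in>A. num_pairs n lam \<mu> \<nu> \<rho> N \<alpha> * alternant N \<kappa> \<alpha>)
    = int (card {(t, u) \<in> chains n lam \<mu> N \<times> chains n \<nu> \<rho> N.
        yamanouchi n t u \<and> (\<forall>i<N. weight n t u i = \<kappa> i)})"
proof -
  let ?Z = "chains n lam \<mu> N \<times> chains n \<nu> \<rho> N"
  let ?w = "\<lambda>(t, u). weight n t u"
  have "(\<Sum>\<alpha>\<in>A. num_pairs n lam \<mu> \<nu> \<rho> N \<alpha> * alternant N \<kappa> \<alpha>)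
      = (\<Sum>\<alpha>\<in>A. \<Sum>z\<in>{z \<in> ?Z. ?w z = \<alpha>}. alternant N \<kappa> (?w z))"
    by (simp add: num_pairs_def case_prod_unfold mem_Times_iff conj_assoc)
  also have "\<dots> = (\<Sum>z\<in>?Z. alternant N \<kappa> (?w z))"
    by (rule sum.group) (use A in \<open>auto simp: finite_chains\<close>)
  also have "\<dots> = (\<Sum>(t, u)\<in>?Z. alternant N \<kappa> (weight n t u))"
    by (simp add: case_prod_unfold)
  finally show ?thesis
    using sum_alternant_weight[of N \<kappa> n lam \<mu> \<nu> \<rho>, OF \<kappa>] by simp
qed

section \<open>Straight shapes, paired with the empty shape\<close>

definition superstandard :: "(nat \<Rightarrow> nat) \<Rightarrow> nat \<Rightarrow> nat \<Rightarrow> nat" where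
  "superstandard \<kappa> k r = (if r < k then \<kappa> r else 0)"

lemma right_cells_superstandard:
  assumes "\<And>i. i \<ge> n \<Longrightarrow> \<kappa> i = 0"
  shows "right_cells n j (superstandard \<kappa> (Suc k)) = right_cells n j (superstandard \<kappa> k) + int (\<kappa> k - j)"
proof -
  have "right_cells n j (superstandard \<kappa> (Suc k)) - right_cells n j (superstandard \<kappa> k)
      = (\<Sum>r<n. if r = k then int (\<kappa> k - j) else 0)"
    unfolding right_cells_def sum_subtractf[symmetric]
    by (intro sum.cong) (auto simp: superstandard_def less_Suc_eq)
  then show ?thesis using assms[of k] by (cases "k < n") auto
qed

lemma interlacing_0: "interlacing n (\<lambda>_ _. 0)"
  by (simp add: interlacing_def)

lemma chains_0: "chains n (\<lambda>_. 0) (\<lambda>_. 0) N = {\<lambda>_ _. 0}"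
proof -
  have "t = (\<lambda>_ _. 0)" if "t \<in> chains n (\<lambda>_. 0) (\<lambda>_. 0) N" for t
    using chains_le[OF that] by (intro ext) simp
  then show ?thesis by (auto simp: chains_def interlacing_0)
qed

lemma excess_0: "excess n (\<lambda>_ _. 0) j k = 0" "col_height n j (\<lambda>_. 0) = 0"
  by (simp_all add: excess_def right_cells_def col_height_def)

context
  fixes \<kappa> :: "nat \<Rightarrow> nat" and N :: nat
  assumes anti: "antimono \<kappa>" and supp: "\<And>i. N \<le> i \<Longrightarrow> \<kappa> i = 0"
begin

lemma superstandard_chain: "superstandard \<kappa> \<in> chains N \<kappa> (\<lambda>_. 0) N"
proof -
  have "\<kappa> (Suc r) \<le> \<kappa> r" for r using anti by (simp add: antimono_def)
  then show ?thesis using supp by (auto simp: chains_def interlacing_def superstandard_def fun_eq_iff)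
qed

lemma weight_superstandard: "weight N (superstandard \<kappa>) (\<lambda>_ _. 0) k = int (\<kappa> k)"
  using right_cells_superstandard[of N \<kappa> 0 k, OF supp] by (simp add: weight_def)

lemma yamanouchi_superstandard: "yamanouchi N (superstandard \<kappa>) (\<lambda>_ _. 0)"
proof -
  have "\<kappa> (Suc k) \<le> \<kappa> k" for k using anti by (simp add: antimono_def)
  then have "excess N (superstandard \<kappa>) j k \<le> 0" for j k
    using right_cells_superstandard[of N \<kappa> j k, OF supp] right_cells_superstandard[of N \<kappa> j "Suc k", OF supp]
    by (simp add: excess_def diff_le_mono)
  moreover have "\<not> dips N (superstandard \<kappa>) (\<lambda>_ _. 0) j k" for j k
  proof -
    have "interlacing N (superstandard \<kappa>)" using superstandard_chain by (simp add: chains_def)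
    from col_height_step(1)[OF this, of j "Suc k"] show ?thesis
      by (auto simp: dips_def height_diff_def excess_0)
  qed
  ultimately show ?thesis
    unfolding yamanouchi_def bad_def excess2_def excess_0 by (metis add.right_neutral not_one_le_zero order_trans)
qed

lemma yamanouchi_imp_superstandard:
  assumes t: "t \<in> chains N \<kappa> (\<lambda>_. 0) N" and yam: "yamanouchi N t (\<lambda>_ _. 0)"
  shows "t = superstandard \<kappa>"
proof -
  have it: "interlacing N t" using t by (simp add: chains_def)
  have zero: "t k r = 0" if "k \<le> r" for k r
    using that
  proof (induction k arbitrary: r)
    case 0
    then show ?case using t by (simp add: chains_def)
  next
    case (Suc k)
    then obtain r' where "r = Suc r'" "k \<le> r'" by (cases r) auto
    then show ?case using Suc.IH[of r'] interlacingD(2)[OF it, of k r'] by simp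
  qed
  have le: "t k r \<le> \<kappa> r" for k r
    using interlacing_mono[OF it, of k "max k N" r] t by (simp add: chains_def)
  have full: "t k r = \<kappa> r" if "r < k" for k r
    using that
  proof (induction r arbitrary: k rule: less_induct)
    case (less r)
    show ?case
    proof (rule ccontr)
      assume "t k r \<noteq> \<kappa> r"
      then have lt: "t k r < \<kappa> r" using le[of k r] by simp
      define l where "l = (LEAST l. t l r = \<kappa> r)"
      have "t N r = \<kappa> r" using t by (simp add: chains_def)
      then have l: "t l r = \<kappa> r" "\<And>i. i < l \<Longrightarrow> t i r \<noteq> \<kappa> r"
        unfolding l_def by (rule LeastI, use not_less_Least in blast)
      have "k < l" using l(1) lt interlacing_mono[OF it, of l k r] by (metis leD leI)
      then obtain q where q: "l = Suc (Suc q)" "r \<le> q"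
        using less.prems by (cases l; cases "l - 1") auto
      \<comment> \<open>Row \<open>r\<close> becomes full at level \<open>l\<close>, so the letter
        \<open>Suc q\<close> stands at its end, in column \<open>j\<close>. No \<open>q\<close> lies
        in column \<open>j\<close> or further right: the rows above \<open>r\<close> are full before
        \<open>q\<close> enters, and from row \<open>r\<close> on the letters up to \<open>q\<close>
        stay left of \<open>j\<close>. This violates the scanning condition.\<close>
      define j where "j = \<kappa> r - 1"
      have small: "t (Suc q) i \<le> j" "t q i \<le> j" if "r \<le> i" for i
      proof -
        have "t (Suc q) r < \<kappa> r" using l(2)[of "Suc q"] q(1) le[of "Suc q" r] by simp
        then show "t (Suc q) i \<le> j"
          using interlacing_antimono[OF it that, of "Suc q"] by (simp add: j_def)
        then show "t q i \<le> j" using interlacingD(1)[OF it, of q i] by simp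
      qed
      have "t (Suc q) i = t q i" if "i < r" for i
        using less.IH[OF that] that q(2) by auto
      then have "t (Suc q) i - j = t q i - j" for i
        using small[of i] by (cases "i < r") auto
      then have "right_cells N j (t (Suc q)) = right_cells N j (t q)"
        by (simp add: right_cells_def)
      moreover have "right_cells N j (t (Suc q)) < right_cells N j (t (Suc (Suc q)))"
        unfolding right_cells_def
      proof (rule sum_strict_mono_ex1)
        have "r < N" using lt supp[of r] by (cases "r < N") auto
        moreover have "int (t (Suc q) r - j) < int (t (Suc (Suc q)) r - j)"
          using small(1)[of r] l(1) lt by (simp add: q(1) j_def)
        ultimately show "\<exists>i\<in>{..<N}. int (t (Suc q) i - j) < int (t (Suc (Suc q)) i - j)" by blast
      qed (use interlacingD(1)[OF it] in \<open>simp_all add: diff_le_mono\<close>)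
      ultimately have "excess N t j q \<ge> 1" by (simp add: excess_def)
      then have "bad N t (\<lambda>_ _. 0) j q" by (simp add: bad_def excess2_def excess_0)
      then show False using yam by (simp add: yamanouchi_def)
    qed
  qed
  show ?thesis
    using zero full by (intro ext) (simp add: superstandard_def)
qed

lemma card_yamanouchi_single:
  "card {(t, u) \<in> chains N \<kappa> (\<lambda>_. 0) N \<times> chains N (\<lambda>_. 0) (\<lambda>_. 0) N.
      yamanouchi N t u \<and> (\<forall>i<N. weight N t u i = \<gamma> i)} = of_bool (\<forall>i<N. int (\<kappa> i) = \<gamma> i)"
proof -
  have "{(t, u) \<in> chains N \<kappa> (\<lambda>_. 0) N \<times> chains N (\<lambda>_. 0) (\<lambda>_. 0) N.
      yamanouchi N t u \<and> (\<forall>i<N. weight N t u i = \<gamma> i)}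
    = (if \<forall>i<N. int (\<kappa> i) = \<gamma> i then {(superstandard \<kappa>, \<lambda>_ _. 0)} else {})"
    (is "?L = ?R")
  proof (rule set_eqI)
    fix z :: "(nat \<Rightarrow> nat \<Rightarrow> nat) \<times> (nat \<Rightarrow> nat \<Rightarrow> nat)"
    obtain t u where z: "z = (t, u)" by (metis surj_pair)
    have "z \<in> ?L \<longleftrightarrow> t \<in> chains N \<kappa> (\<lambda>_. 0) N \<and> u = (\<lambda>_ _. 0) \<and> yamanouchi N t u \<and> (\<forall>i<N. weight N t u i = \<gamma> i)"
      by (auto simp: z chains_0)
    also have "\<dots> \<longleftrightarrow> t = superstandard \<kappa> \<and> u = (\<lambda>_ _. 0) \<and> (\<forall>i<N. weight N t u i = \<gamma> i)"
      using yamanouchi_imp_superstandard superstandard_chain yamanouchi_superstandard by blast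
    also have "\<dots> \<longleftrightarrow> z \<in> ?R"
      by (simp add: z weight_superstandard cong: conj_cong)
    finally show "z \<in> ?L \<longleftrightarrow> z \<in> ?R" .
  qed
  then show ?thesis by simp
qed

end

text \<open>Both sides are symmetric and have equal sums against \<open>alternant N \<gamma>\<close>
  for dominant \<open>\<gamma>\<close>: the left side counts Yamanouchi pairs of weight
  \<open>\<gamma>\<close>, and on the right each \<open>\<kappa>\<close> has a single one, of weight
  \<open>\<kappa>\<close>. Hence \<open>symmetric_eq_zero\<close> applies to the difference.\<close>

lemma num_pairs_expansion:
  assumes P: "finite P" "\<And>\<kappa>. \<kappa> \<in> P \<Longrightarrow> antimono \<kappa>" "\<And>\<kappa> i. \<kappa> \<in> P \<Longrightarrow> N \<le> i \<Longrightarrow> \<kappa> i = (0::nat)"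
    and yam: "\<And>t u. t \<in> chains n lam \<mu> N \<Longrightarrow> u \<in> chains n \<nu> \<rho> N \<Longrightarrow> yamanouchi n t u
      \<Longrightarrow> \<exists>\<kappa>\<in>P. weight n t u = int \<circ> \<kappa>"
  shows "num_pairs n lam \<mu> \<nu> \<rho> N \<alpha> = (\<Sum>\<kappa>\<in>P.
    int (card {(t, u) \<in> chains n lam \<mu> N \<times> chains n \<nu> \<rho> N. yamanouchi n t u \<and> weight n t u = int \<circ> \<kappa>})
      * num_pairs N \<kappa> (\<lambda>_. 0) (\<lambda>_. 0) (\<lambda>_. 0) N \<alpha>)"
proof -
  let ?Z = "chains n lam \<mu> N \<times> chains n \<nu> \<rho> N"
  let ?Z' = "\<lambda>\<kappa>. chains N \<kappa> (\<lambda>_. 0) N \<times> chains N (\<lambda>_. 0) (\<lambda>_. 0) N"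
  let ?c = "\<lambda>\<kappa>. int (card {(t, u) \<in> ?Z. yamanouchi n t u \<and> weight n t u = int \<circ> \<kappa>})"
  let ?F = "num_pairs n lam \<mu> \<nu> \<rho> N" and ?K = "\<lambda>\<kappa>. num_pairs N \<kappa> (\<lambda>_. 0) (\<lambda>_. 0) (\<lambda>_. 0) N"
  define A where "A = (\<lambda>(t, u). weight n t u) ` ?Z \<union> (\<Union>\<kappa>\<in>P. (\<lambda>(t, u). weight N t u) ` ?Z' \<kappa>)"
  define f where "f \<alpha> = ?F \<alpha> - (\<Sum>\<kappa>\<in>P. ?c \<kappa> * ?K \<kappa> \<alpha>)" for \<alpha>
  have fin: "finite A" using P(1) by (simp add: A_def finite_chains)
  have wA: "t \<in> chains n lam \<mu> N \<Longrightarrow> u \<in> chains n \<nu> \<rho> N \<Longrightarrow> weight n t u \<in> A" for t u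
    by (force simp: A_def)
  have wA': "t \<in> chains N \<kappa> (\<lambda>_. 0) N \<Longrightarrow> u \<in> chains N (\<lambda>_. 0) (\<lambda>_. 0) N \<Longrightarrow> weight N t u \<in> A"
    if "\<kappa> \<in> P" for t u \<kappa>
    using that by (force simp: A_def)
  have "f \<alpha> = 0"
  proof (rule symmetric_eq_zero[where N = N and f = f, OF fin])
    fix \<alpha> assume "f \<alpha> \<noteq> 0"
    then show "\<alpha> \<in> A"
    proof (rule contrapos_np)
      assume "\<alpha> \<notin> A"
      then have "?F \<alpha> = 0" "\<kappa> \<in> P \<Longrightarrow> ?K \<kappa> \<alpha> = 0" for \<kappa>
        unfolding num_pairs_def using wA wA' by (auto intro!: arg_cong[where f = card] simp: card_eq_0_iff)
      then show "f \<alpha> = 0" by (simp add: f_def)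
    qed
  next
    show "\<alpha> \<in> A \<Longrightarrow> N \<le> i \<Longrightarrow> \<alpha> i = 0" for \<alpha> i
      by (auto simp: A_def weight_eq_0)
  next
    show "Suc k < N \<Longrightarrow> f (\<alpha> \<circ> transpose k (Suc k)) = f \<alpha>" for \<alpha> k
      by (simp add: f_def num_pairs_symmetric)
  next
    fix \<gamma> assume \<gamma>: "\<gamma> \<in> A" "\<And>i. Suc i < N \<Longrightarrow> \<gamma> (Suc i) \<le> \<gamma> i"
    have \<gamma>0: "\<gamma> i = 0" if "N \<le> i" for i
      using \<gamma>(1) that by (auto simp: A_def weight_eq_0)
    have eq_iff: "(\<forall>i<N. w i = \<gamma> i) \<longleftrightarrow> w = \<gamma>" if "\<And>i. N \<le> i \<Longrightarrow> w i = 0" for w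
      using \<gamma>0 that by (metis ext not_less)
    have K: "(\<Sum>\<alpha>\<in>A. ?K \<kappa> \<alpha> * alternant N \<gamma> \<alpha>) = of_bool (int \<circ> \<kappa> = \<gamma>)" if "\<kappa> \<in> P" for \<kappa>
      using sum_num_pairs_alternant[where \<kappa> = \<gamma>, OF fin wA'[OF that] \<gamma>(2)] card_yamanouchi_single[OF P(2,3)[OF that], of N \<gamma>]
        eq_iff[of "int \<circ> \<kappa>"] P(3)[OF that] by simp
    have "(\<Sum>\<alpha>\<in>A. ?F \<alpha> * alternant N \<gamma> \<alpha>) = int (card {(t, u) \<in> ?Z.
        yamanouchi n t u \<and> (\<forall>i<N. weight n t u i = \<gamma> i)})"
      by (rule sum_num_pairs_alternant[where \<kappa> = \<gamma>, OF fin wA \<gamma>(2)])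
    moreover have "{(t, u) \<in> ?Z. yamanouchi n t u \<and> (\<forall>i<N. weight n t u i = \<gamma> i)}
        = {(t, u) \<in> ?Z. yamanouchi n t u \<and> weight n t u = \<gamma>}"
      by (rule Collect_cong) (use eq_iff[OF weight_eq_0] in auto)
    ultimately have F: "(\<Sum>\<alpha>\<in>A. ?F \<alpha> * alternant N \<gamma> \<alpha>)
        = int (card {(t, u) \<in> ?Z. yamanouchi n t u \<and> weight n t u = \<gamma>})"
      by (simp only:)
    have "(\<Sum>\<alpha>\<in>A. f \<alpha> * alternant N \<gamma> \<alpha>) = (\<Sum>\<alpha>\<in>A. ?F \<alpha> * alternant N \<gamma> \<alpha>)
        - (\<Sum>\<alpha>\<in>A. \<Sum>\<kappa>\<in>P. ?c \<kappa> * (?K \<kappa> \<alpha> * alternant N \<gamma> \<alpha>))"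
      unfolding f_def left_diff_distrib sum_subtractf sum_distrib_right mult.assoc ..
    also have "(\<Sum>\<alpha>\<in>A. \<Sum>\<kappa>\<in>P. ?c \<kappa> * (?K \<kappa> \<alpha> * alternant N \<gamma> \<alpha>))
        = (\<Sum>\<kappa>\<in>P. ?c \<kappa> * (\<Sum>\<alpha>\<in>A. ?K \<kappa> \<alpha> * alternant N \<gamma> \<alpha>))"
      unfolding sum_distrib_left by (rule sum.swap)
    also have "\<dots> = (\<Sum>\<kappa>\<in>P. if int \<circ> \<kappa> = \<gamma> then ?c \<kappa> else 0)"
      by (intro sum.cong) (simp_all add: K)
    also have "\<dots> = int (card {(t, u) \<in> ?Z. yamanouchi n t u \<and> weight n t u = \<gamma>})"
    proof (cases "\<exists>\<kappa>\<in>P. int \<circ> \<kappa> = \<gamma>")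
      case True
      then obtain \<kappa> where \<kappa>: "\<kappa> \<in> P" "int \<circ> \<kappa> = \<gamma>" by blast
      then have "int \<circ> \<kappa>' = \<gamma> \<longleftrightarrow> \<kappa>' = \<kappa>" for \<kappa>'
        by (metis comp_apply ext of_nat_eq_iff)
      then have "(\<Sum>\<kappa>\<in>P. if int \<circ> \<kappa> = \<gamma> then ?c \<kappa> else 0) = ?c \<kappa>"
        using \<kappa>(1) P(1) by (simp add: sum.delta)
      then show ?thesis by (simp only: \<kappa>(2))
    next
      case False
      then have "{(t, u) \<in> ?Z. yamanouchi n t u \<and> weight n t u = \<gamma>} = {}"
        using yam by fastforce
      then have "int (card {(t, u) \<in> ?Z. yamanouchi n t u \<and> weight n t u = \<gamma>}) = 0"
        by (simp only: card.empty of_nat_0)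
      then show ?thesis using False by (simp add: sum.neutral)
    qed
    finally show "(\<Sum>\<alpha>\<in>A. f \<alpha> * alternant N \<gamma> \<alpha>) = 0"
      using F by simp
  qed
  then show ?thesis by (simp add: f_def)
qed

section \<open>Cell transfer\<close>

text \<open>\<open>blocking t u k r k' r'\<close> says that the interlacing inequality from \<open>(k, r)\<close> to \<open>(k', r')\<close>
  could be destroyed by exchanging \<open>t\<close> and \<open>u\<close> at only one of the two places. It depends only on the
  unordered pairs of values, so the exchanged pair determines the region that was exchanged.\<close>

definition blocking :: "(nat \<Rightarrow> nat \<Rightarrow> nat) \<Rightarrow> (nat \<Rightarrow> nat \<Rightarrow> nat) \<Rightarrow> nat \<Rightarrow> nat \<Rightarrow> nat \<Rightarrow> nat \<Rightarrow> bool" where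
  "blocking t u k r k' r' \<longleftrightarrow> (k' = Suc k \<and> r' = r \<or> k = Suc k' \<and> r = Suc r') \<and>
     min (t k' r') (u k' r') < max (t k r) (u k r)"

text \<open>The union of the connected components that meet \<open>B\<close>, with \<open>E\<close>
  read as an undirected graph.\<close>

inductive region :: "(nat \<Rightarrow> nat \<Rightarrow> nat \<Rightarrow> nat \<Rightarrow> bool) \<Rightarrow> (nat \<times> nat) set \<Rightarrow> nat \<Rightarrow> nat \<Rightarrow> bool"
  for E B where
  region_base: "(k, r) \<in> B \<Longrightarrow> region E B k r"
| region_step: "region E B k r \<Longrightarrow> E k r k' r' \<or> E k' r' k r \<Longrightarrow> region E B k' r'"

text \<open>The places on the boundary where the first tableau falls short of the maximum, so that
  the exchange is forced.\<close>

definition deficit :: "(nat \<Rightarrow> nat) \<Rightarrow> (nat \<Rightarrow> nat) \<Rightarrow> (nat \<Rightarrow> nat) \<Rightarrow> (nat \<Rightarrow> nat) \<Rightarrow> nat \<Rightarrow> (nat \<times> nat) set" where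
  "deficit lam \<mu> \<nu> \<rho> N = {(k, r). k = 0 \<and> \<mu> r < \<rho> r \<or> N \<le> k \<and> lam r < \<nu> r}"

definition exchange :: "(nat \<Rightarrow> nat \<Rightarrow> bool) \<Rightarrow> (nat \<Rightarrow> nat \<Rightarrow> nat) \<Rightarrow> (nat \<Rightarrow> nat \<Rightarrow> nat) \<Rightarrow> nat \<Rightarrow> nat \<Rightarrow> nat" where
  "exchange R t u = (\<lambda>k r. if R k r then u k r else t k r)"

lemma blocking_exchange: "blocking (exchange R t u) (exchange R u t) = blocking t u"
  by (intro ext) (auto simp: blocking_def exchange_def min.commute max.commute)

lemma interlacing_exchange:
  fixes B :: "(nat \<times> nat) set"
  assumes "interlacing n t" "interlacing n u"
  defines "R \<equiv> region (blocking t u) B"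
  shows "interlacing n (exchange R t u)"
proof -
  have same: "R k r = R k' r'" if "blocking t u k r k' r'" for k r k' r'
    using that region_step unfolding R_def by metis
  note d = interlacingD[OF assms(1)] interlacingD[OF assms(2)]
  have "exchange R t u k r \<le> exchange R t u (Suc k) r" for k r
  proof (cases "R k r = R (Suc k) r")
    case False
    then have "max (t k r) (u k r) \<le> min (t (Suc k) r) (u (Suc k) r)"
      using same[of k r "Suc k" r] by (auto simp: blocking_def simp flip: not_less)
    then show ?thesis by (simp add: exchange_def)
  qed (simp add: exchange_def d)
  moreover have "exchange R t u (Suc k) (Suc r) \<le> exchange R t u k r" for k r
  proof (cases "R (Suc k) (Suc r) = R k r")
    case False
    then have "max (t (Suc k) (Suc r)) (u (Suc k) (Suc r)) \<le> min (t k r) (u k r)"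
      using same[of "Suc k" "Suc r" k r] by (auto simp: blocking_def simp flip: not_less)
    then show ?thesis by (simp add: exchange_def)
  qed (simp add: exchange_def d)
  ultimately show ?thesis
    using d(3,6) by (simp add: interlacing_def exchange_def)
qed

text \<open>If column \<open>j\<close> of \<open>u\<close> is not the longer one, exchanges at
  places with \<open>t k r < u k r\<close> do not affect that column. Otherwise the rows by which
  \<open>u\<close> is longer lie in one component, so either all or none of them are
  exchanged.\<close>

lemma height_diff_exchange:
  fixes B :: "(nat \<times> nat) set"
  assumes t: "interlacing n t" and u: "interlacing n u"
    and less: "\<And>k r. region (blocking t u) B k r \<Longrightarrow> t k r < u k r"
  defines "R \<equiv> region (blocking t u) B"
  shows "height_diff n (exchange R t u) (exchange R u t) j k = height_diff n t u j k \<or>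
    height_diff n t u j k < 0 \<and>
    height_diff n (exchange R t u) (exchange R u t) j k = - height_diff n t u j k"
proof -
  let ?a = "col_height n j (t k)" and ?b = "col_height n j (u k)"
  let ?t = "exchange R t u" and ?u = "exchange R u t"
  note iff = less_col_height_iff[OF t, of _ j k] less_col_height_iff[OF u, of _ j k]
  have same: "R k r = R k' r'" if "blocking t u k r k' r'" for k r k' r'
    using that region_step unfolding R_def by metis
  have cong: "col_height n j x = col_height n j y" if "\<And>r. j < x r \<longleftrightarrow> j < y r" for x y
    by (simp add: col_height_def that)
  show ?thesis
  proof (cases "?b \<le> ?a")
    case True
    have "j < t k r \<longleftrightarrow> j < u k r" if "R k r" for r
      using less[of k r] that True iff[of r] unfolding R_def by linarith
    then have "j < ?t k r \<longleftrightarrow> j < t k r" "j < ?u k r \<longleftrightarrow> j < u k r" for r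
      by (auto simp: exchange_def)
    then show ?thesis
      using cong[of "?t k" "t k"] cong[of "?u k" "u k"] by (simp add: height_diff_def)
  next
    case False
    have R_eq: "R k r = R k ?a" if "?a \<le> r" "r < ?b" for r
      using that
    proof (induction rule: dec_induct)
      case (step r)
      have 1: "t k r \<le> j" "j < u k (Suc r)"
        using step iff[of r] iff[of "Suc r"] by auto
      have 2: "t (Suc k) (Suc r) \<le> t k r" "u k (Suc r) \<le> u (Suc k) (Suc r)"
        using interlacingD(2)[OF t] interlacingD(1)[OF u] by auto
      \<comment> \<open>Rows \<open>r\<close> and \<open>Suc r\<close> of level \<open>k\<close> are
        linked through row \<open>Suc r\<close> of level \<open>Suc k\<close>.\<close>
      have "blocking t u k (Suc r) (Suc k) (Suc r)" "blocking t u (Suc k) (Suc r) k r"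
        using 1 2 by (auto simp: blocking_def)
      from this[THEN same] show ?case using step by simp
    qed simp
    show ?thesis
    proof (cases "R k ?a")
      case R: True
      have "j < ?t k r \<longleftrightarrow> j < u k r" "j < ?u k r \<longleftrightarrow> j < t k r" for r
        using R_eq[of r] iff[of r] R False by (auto simp: exchange_def not_le not_less)
      then show ?thesis
        using cong[of "?t k" "u k"] cong[of "?u k" "t k"] False by (simp add: height_diff_def)
    next
      case R: False
      have "j < t k r \<longleftrightarrow> j < u k r" if "R k r" for r
        using R_eq[of r] R iff[of r] False that by (metis le_less_trans not_le order_less_le_trans less_imp_le)
      then have "j < ?t k r \<longleftrightarrow> j < t k r" "j < ?u k r \<longleftrightarrow> j < u k r" for r
        by (auto simp: exchange_def)
      then show ?thesis
        using cong[of "?t k" "t k"] cong[of "?u k" "u k"] by (simp add: height_diff_def)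
    qed
  qed
qed

lemma right_cells_exchange:
  "right_cells n j (exchange R t u k) + right_cells n j (exchange R u t k)
    = right_cells n j (t k) + right_cells n j (u k)"
  unfolding right_cells_def sum.distrib[symmetric] by (rule sum.cong) (auto simp: exchange_def)

lemma weight_exchange: "weight n (exchange R t u) (exchange R u t) = weight n t u"
  using right_cells_exchange[of n 0 R t u] by (intro ext) (simp add: weight_def algebra_simps)

lemma excess2_exchange: "excess2 n (exchange R t u) (exchange R u t) j k = excess2 n t u j k"
  using right_cells_exchange[of n j R t u k] right_cells_exchange[of n j R t u "Suc k"]
    right_cells_exchange[of n j R t u "Suc (Suc k)"]
  by (simp add: excess2_def excess_def)

lemma yamanouchi_exchange:
  fixes B :: "(nat \<times> nat) set"
  assumes t: "interlacing n t" and u: "interlacing n u"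
    and less: "\<And>k r. region (blocking t u) B k r \<Longrightarrow> t k r < u k r"
    and yam: "yamanouchi n t u"
  defines "R \<equiv> region (blocking t u) B"
  shows "yamanouchi n (exchange R t u) (exchange R u t)"
proof -
  let ?h = "height_diff n t u" and ?h' = "height_diff n (exchange R t u) (exchange R u t)"
  have h: "?h' j k = ?h j k \<or> ?h j k < 0 \<and> ?h' j k = - ?h j k" for j k
    using height_diff_exchange[OF t u less] by (simp add: R_def)
  have step: "\<bar>?h j (Suc k) - ?h j k\<bar> \<le> 1" for j k
    using col_height_step[OF t, of j k] col_height_step[OF u, of j k]
    by (simp add: height_diff_def)
  \<comment> \<open>The exchange can only turn a negative height difference positive. As a height difference
    changes by at most one per letter, only \<open>0, -1, 0\<close>, which dips and may become \<open>0, 1, 0\<close>,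
    changes its status.\<close>
  have "dips n t u j k" if "dips n (exchange R t u) (exchange R u t) j k" for j k
    using that h[of j k] h[of j "Suc k"] h[of j "Suc (Suc k)"] step[of j k] step[of j "Suc k"]
    unfolding dips_def by (smt (verit))
  then show ?thesis
    using yam by (auto simp: yamanouchi_def bad_def excess2_exchange)
qed

text \<open>Along a link both tableaux increase weakly, yet some value at its end is below some
  value at its start. If \<open>t < u\<close> holds at one end, this can only be \<open>t\<close> at
  the end below \<open>u\<close> at the start, which forces \<open>t < u\<close> at the other end
  too.\<close>

lemma region_deficit_less:
  assumes "t \<in> chains n lam \<mu> N" "u \<in> chains n \<nu> \<rho> N"
    and "region (blocking t u) (deficit lam \<mu> \<nu> \<rho> N) k r"
  shows "t k r < u k r"
  using assms(3)
proof induction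
  case (region_base k r)
  then show ?case using assms(1,2) by (auto simp: deficit_def chains_def)
next
  case (region_step k r k' r')
  have "blocking t u k r k' r' \<Longrightarrow> t k r \<le> t k' r' \<and> u k r \<le> u k' r'" for k r k' r'
    using assms(1,2) interlacingD(1,2)[of n t] interlacingD(1,2)[of n u]
    by (auto simp: blocking_def chains_def)
  from this[of k r k' r'] this[of k' r' k r] show ?case
    using region_step(2,3) by (auto simp: blocking_def)
qed

lemma card_yamanouchi_transfer:
  "card {(t, u) \<in> chains n lam \<mu> N \<times> chains n \<nu> \<rho> N. yamanouchi n t u \<and> weight n t u = \<kappa>}
    \<le> card {(t, u) \<in> chains n (\<lambda>r. max (lam r) (\<nu> r)) (\<lambda>r. max (\<mu> r) (\<rho> r)) N
          \<times> chains n (\<lambda>r. min (lam r) (\<nu> r)) (\<lambda>r. min (\<mu> r) (\<rho> r)) N.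
        yamanouchi n t u \<and> weight n t u = \<kappa>}" (is "card ?Y \<le> card ?X")
proof (rule card_inj_on_le)
  let ?R = "\<lambda>t u. region (blocking t u) (deficit lam \<mu> \<nu> \<rho> N)"
  let ?f = "\<lambda>(t, u). (exchange (?R t u) t u, exchange (?R t u) u t)"
  show "inj_on ?f ?Y"
  proof (rule inj_onI)
    fix y z assume eq: "?f y = ?f z"
    obtain t u t' u' where [simp]: "y = (t, u)" "z = (t', u')" by (metis surj_pair)
    have "?R t u = ?R t' u'"
      using eq blocking_exchange[of "?R t u" t u] blocking_exchange[of "?R t' u'" t' u'] by simp
    moreover have "exchange R (exchange R a b) (exchange R b a) = a" for R a b
      by (intro ext) (simp add: exchange_def)
    ultimately show "y = z" using eq by simp metis
  qed
  show "?f ` ?Y \<subseteq> ?X"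
  proof clarify
    fix t u assume t: "t \<in> chains n lam \<mu> N" and u: "u \<in> chains n \<nu> \<rho> N"
      and yam: "yamanouchi n t u"
    have it: "interlacing n t" and iu: "interlacing n u" using t u by (auto simp: chains_def)
    note less = region_deficit_less[OF t u]
    \<comment> \<open>Because \<open>t < u\<close> throughout the region, it meets the boundary
      levels in the deficit only; hence the new ends are exactly maximum and minimum.\<close>
    have R0: "?R t u 0 r \<longleftrightarrow> \<mu> r < \<rho> r" for r
      using less[of 0 r] t u by (auto simp: chains_def deficit_def intro: region_base)
    have RN: "?R t u k r \<longleftrightarrow> lam r < \<nu> r" if "N \<le> k" for k r
      using less[of k r] t u that by (auto simp: chains_def deficit_def intro: region_base)
    have "blocking u t = blocking t u"
      by (intro ext) (auto simp: blocking_def min.commute max.commute)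
    then have "interlacing n (exchange (?R t u) t u)" "interlacing n (exchange (?R t u) u t)"
      using interlacing_exchange[OF it iu] interlacing_exchange[OF iu it] by auto
    then have "exchange (?R t u) t u \<in> chains n (\<lambda>r. max (lam r) (\<nu> r)) (\<lambda>r. max (\<mu> r) (\<rho> r)) N"
      "exchange (?R t u) u t \<in> chains n (\<lambda>r. min (lam r) (\<nu> r)) (\<lambda>r. min (\<mu> r) (\<rho> r)) N"
      using t u R0 RN by (auto simp: chains_def exchange_def fun_eq_iff)
    then show "(exchange (?R t u) t u, exchange (?R t u) u t)
        \<in> chains n (\<lambda>r. max (lam r) (\<nu> r)) (\<lambda>r. max (\<mu> r) (\<rho> r)) N
          \<times> chains n (\<lambda>r. min (lam r) (\<nu> r)) (\<lambda>r. min (\<mu> r) (\<rho> r)) N \<and>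
        yamanouchi n (exchange (?R t u) t u) (exchange (?R t u) u t) \<and>
        weight n (exchange (?R t u) t u) (exchange (?R t u) u t) = weight n t u"
      using yamanouchi_exchange[OF it iu less yam] weight_exchange[of n "?R t u" t u] by auto
  qed
  show "finite ?X"
    by (rule finite_subset[of _ "chains n (\<lambda>r. max (lam r) (\<nu> r)) (\<lambda>r. max (\<mu> r) (\<rho> r)) N
          \<times> chains n (\<lambda>r. min (lam r) (\<nu> r)) (\<lambda>r. min (\<mu> r) (\<rho> r)) N"])
      (auto simp: finite_chains)
qed

section \<open>Tableaux and chains\<close>

definition chain_weight :: "nat \<Rightarrow> (nat \<Rightarrow> nat \<Rightarrow> nat) \<Rightarrow> nat \<Rightarrow> int" where
  "chain_weight n t k = right_cells n 0 (t (Suc k)) - right_cells n 0 (t k)"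

text \<open>A relation in which chain and extensional tableau determine each other; both
  translations satisfy it, which makes them mutually inverse.\<close>

definition encodes :: "(nat \<Rightarrow> nat) \<Rightarrow> (nat \<Rightarrow> nat) \<Rightarrow> (nat \<times> nat \<Rightarrow> nat) \<Rightarrow> (nat \<Rightarrow> nat \<Rightarrow> nat) \<Rightarrow> bool" where
  "encodes lam \<mu> T t \<longleftrightarrow> (\<forall>k r. \<mu> r \<le> t k r \<and> t k r \<le> lam r) \<and>
     (\<forall>k r j. \<mu> r \<le> j \<longrightarrow> j < lam r \<longrightarrow> (T (r, j) < k \<longleftrightarrow> j < t k r))"

definition chain_of :: "(nat \<Rightarrow> nat) \<Rightarrow> (nat \<Rightarrow> nat) \<Rightarrow> (nat \<times> nat \<Rightarrow> nat) \<Rightarrow> nat \<Rightarrow> nat \<Rightarrow> nat" where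
  "chain_of lam \<mu> T k r = \<mu> r + card {j. \<mu> r \<le> j \<and> j < lam r \<and> T (r, j) < k}"

definition tableau_of :: "(nat \<Rightarrow> nat) \<Rightarrow> (nat \<Rightarrow> nat) \<Rightarrow> (nat \<Rightarrow> nat \<Rightarrow> nat) \<Rightarrow> nat \<times> nat \<Rightarrow> nat" where
  "tableau_of lam \<mu> t = restrict (\<lambda>(r, j). LEAST k. j < t (Suc k) r) (skew_diagram lam \<mu>)"

lemma encodes_chain_of:
  assumes shape: "skew_shape lam \<mu>" and T: "T \<in> ssyt lam \<mu>"
  shows "encodes lam \<mu> T (chain_of lam \<mu> T)"
proof -
  let ?S = "\<lambda>k r. {j. \<mu> r \<le> j \<and> j < lam r \<and> T (r, j) < k}"
  have fin: "finite (?S k r)" for k r by simp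
  have row: "T (r, j) \<le> T (r, j')" if "\<mu> r \<le> j" "j \<le> j'" "j' < lam r" for r j j'
    using T that by (cases "j = j'") (auto simp: ssyt_def skew_diagram_def)
  have "card (?S k r) \<le> card {\<mu> r..<lam r}" for k r
    by (rule card_mono) auto
  then have "chain_of lam \<mu> T k r \<le> lam r" for k r
    using shape by (simp add: chain_of_def skew_shape_def le_diff_conv2 add.commute)
  moreover have "T (r, j) < k \<longleftrightarrow> j < chain_of lam \<mu> T k r" if j: "\<mu> r \<le> j" "j < lam r" for k r j
  proof
    assume "T (r, j) < k"
    then have "T (r, i) < k" if "\<mu> r \<le> i" "i \<le> j" for i
      using row[OF that j(2)] by simp
    then have "{\<mu> r..j} \<subseteq> ?S k r"
      using j by auto
    from card_mono[OF fin this] show "j < chain_of lam \<mu> T k r"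
      using j by (simp add: chain_of_def)
  next
    assume less: "j < chain_of lam \<mu> T k r"
    show "T (r, j) < k"
    proof (rule ccontr)
      assume "\<not> T (r, j) < k"
      then have "\<not> T (r, i) < k" if "j \<le> i" "i < lam r" for i
        using row[OF j(1) that] by simp
      then have "?S k r \<subseteq> {\<mu> r..<j}"
        by (auto simp: not_le[symmetric])
      from card_mono[OF _ this] show False
        using less j by (simp add: chain_of_def)
    qed
  qed
  ultimately show ?thesis by (simp add: encodes_def chain_of_def)
qed

lemma encodes_tableau_of:
  assumes t: "t \<in> chains n lam \<mu> N"
  shows "encodes lam \<mu> (tableau_of lam \<mu> t) t"
proof -
  have it: "interlacing n t" and t0: "t 0 = \<mu>" and tN: "\<And>k. N \<le> k \<Longrightarrow> t k = lam"
    using t by (auto simp: chains_def)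
  have "\<mu> r \<le> t k r \<and> t k r \<le> lam r" for k r
    using interlacing_mono[OF it, of 0 k r] interlacing_mono[OF it, of k "max k N" r] t0 tN by simp
  moreover have "tableau_of lam \<mu> t (r, j) < k \<longleftrightarrow> j < t k r" if j: "\<mu> r \<le> j" "j < lam r" for k r j
  proof -
    let ?l = "LEAST k. j < t (Suc k) r"
    have "j < t (Suc N) r" using tN j by simp
    then have l: "j < t (Suc ?l) r" by (rule LeastI)
    have "?l < k \<longleftrightarrow> j < t k r"
    proof
      show "?l < k \<Longrightarrow> j < t k r"
        using l interlacing_mono[OF it, of "Suc ?l" k r] by (simp add: Suc_le_eq)
      show "j < t k r \<Longrightarrow> ?l < k"
        using t0 j by (cases k) (auto intro: Least_le le_imp_less_Suc)
    qed
    then show ?thesis using j by (simp add: tableau_of_def skew_diagram_def)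
  qed
  ultimately show ?thesis by (simp add: encodes_def)
qed

lemma encodes_chain_unique:
  assumes "encodes lam \<mu> T t" "encodes lam \<mu> T t'"
  shows "t = t'"
proof (intro ext)
  fix k r
  have b: "\<mu> r \<le> t k r" "t k r \<le> lam r" "\<mu> r \<le> t' k r" "t' k r \<le> lam r"
    using assms by (auto simp: encodes_def)
  have "j < t k r \<longleftrightarrow> j < t' k r" if "\<mu> r \<le> j" "j < lam r" for j
    using assms that unfolding encodes_def by metis
  from this[of "t k r"] this[of "t' k r"] b show "t k r = t' k r" by linarith
qed

lemma encodes_tableau_unique:
  assumes "encodes lam \<mu> T t" "encodes lam \<mu> T' t"
    and "T \<in> extensional (skew_diagram lam \<mu>)" "T' \<in> extensional (skew_diagram lam \<mu>)"
  shows "T = T'"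
proof (rule extensionalityI[OF assms(3,4)])
  fix b assume "b \<in> skew_diagram lam \<mu>"
  then obtain r j where b: "b = (r, j)" "\<mu> r \<le> j" "j < lam r"
    by (auto simp: skew_diagram_def)
  have "T b < k \<longleftrightarrow> T' b < k" for k
    using assms(1,2) b unfolding encodes_def by metis
  then show "T b = T' b" by (metis linorder_neq_iff)
qed

lemma card_letter:
  assumes enc: "encodes lam \<mu> T t" and rows: "\<And>r. n \<le> r \<Longrightarrow> lam r = 0" and le: "\<And>k r. t k r \<le> t (Suc k) r"
  shows "int (card {b \<in> skew_diagram lam \<mu>. T b = k}) = chain_weight n t k"
proof -
  have "b \<in> skew_diagram lam \<mu> \<and> T b = k \<longleftrightarrow> b \<in> (SIGMA r:{..<n}. {t k r..<t (Suc k) r})" for b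
  proof -
    obtain r j where b: "b = (r, j)" by (cases b)
    have bd: "\<mu> r \<le> t k r" "t (Suc k) r \<le> lam r"
      using enc by (auto simp: encodes_def)
    have "T (r, j) = k \<longleftrightarrow> t k r \<le> j \<and> j < t (Suc k) r" if "\<mu> r \<le> j" "j < lam r"
    proof -
      have "T (r, j) < k \<longleftrightarrow> j < t k r" "T (r, j) < Suc k \<longleftrightarrow> j < t (Suc k) r"
        using enc that by (auto simp: encodes_def)
      then show ?thesis by linarith
    qed
    then show ?thesis
      using bd rows[of r] by (cases "r < n") (auto simp: b skew_diagram_def)
  qed
  then have "{b \<in> skew_diagram lam \<mu>. T b = k} = (SIGMA r:{..<n}. {t k r..<t (Suc k) r})" by blast
  then show ?thesis
    using le by (simp add: chain_weight_def right_cells_def sum_subtractf[symmetric] of_nat_diff)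
qed

lemma ssyt_encodes_interlacing:
  assumes shape: "skew_shape lam \<mu>" and rows: "\<And>r. n \<le> r \<Longrightarrow> lam r = 0"
    and T: "T \<in> ssyt lam \<mu>" and enc: "encodes lam \<mu> T t"
  shows "interlacing n t" "t 0 = \<mu>"
proof -
  have bd: "\<mu> r \<le> t k r" "t k r \<le> lam r" for k r
    using enc by (auto simp: encodes_def)
  have iff: "T (r, j) < k \<longleftrightarrow> j < t k r" if "\<mu> r \<le> j" "j < lam r" for k r j
    using enc that by (auto simp: encodes_def)
  have anti: "\<mu> (Suc r) \<le> \<mu> r" "lam (Suc r) \<le> lam r" for r
    using shape by (auto simp: skew_shape_def is_partition_def antimono_def)
  have "t k r \<le> t (Suc k) r" for k r
  proof (rule ccontr)
    assume "\<not> t k r \<le> t (Suc k) r"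
    then show False
      using iff[of r "t (Suc k) r" k] iff[of r "t (Suc k) r" "Suc k"] bd(1)[of r "Suc k"] bd(2)[of k r] by auto
  qed
  moreover have "t (Suc k) (Suc r) \<le> t k r" for k r
  proof (rule ccontr)
    let ?j = "t k r"
    assume "\<not> t (Suc k) (Suc r) \<le> ?j"
    then have less: "?j < t (Suc k) (Suc r)" by simp
    then have cells: "\<mu> r \<le> ?j" "?j < lam r" "\<mu> (Suc r) \<le> ?j" "?j < lam (Suc r)"
      using bd(1)[of r k] bd(2)[of "Suc k" "Suc r"] anti[of r] by auto
    then have "T (r, ?j) < T (Suc r, ?j)"
      using T by (auto simp: ssyt_def skew_diagram_def)
    moreover have "T (Suc r, ?j) < Suc k" "\<not> T (r, ?j) < k"
      using iff[OF cells(3,4), of "Suc k"] iff[OF cells(1,2), of k] less by auto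
    ultimately show False by simp
  qed
  ultimately show "interlacing n t"
    using bd(2) rows by (simp add: interlacing_def) (metis le_zero_eq)
  show "t 0 = \<mu>"
  proof
    fix r show "t 0 r = \<mu> r"
      using iff[of r "\<mu> r" 0] bd(1)[of r 0] bd(2)[of 0 r] by (cases "\<mu> r < t 0 r") auto
  qed
qed

lemma tableau_of_ssyt:
  assumes t: "t \<in> chains n lam \<mu> N"
  shows "tableau_of lam \<mu> t \<in> ssyt lam \<mu>"
proof -
  let ?T = "tableau_of lam \<mu> t"
  have it: "interlacing n t" using t by (simp add: chains_def)
  have iff: "?T (r, j) < k \<longleftrightarrow> j < t k r" if "(r, j) \<in> skew_diagram lam \<mu>" for k r j
    using encodes_tableau_of[OF t] that by (auto simp: encodes_def skew_diagram_def)
  have "?T (i, j) \<le> ?T (i, j')"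
    if "(i, j) \<in> skew_diagram lam \<mu>" "(i, j') \<in> skew_diagram lam \<mu>" "j < j'" for i j j'
    using iff[OF that(1), of "Suc (?T (i, j'))"] iff[OF that(2), of "Suc (?T (i, j'))"] that(3) by simp
  moreover have "?T (i, j) < ?T (i', j)"
    if "(i, j) \<in> skew_diagram lam \<mu>" "(i', j) \<in> skew_diagram lam \<mu>" "i < i'" for i i' j
  proof -
    let ?v = "?T (i', j)"
    have "j < t (Suc ?v) i'" using iff[OF that(2), of "Suc ?v"] by simp
    also have "\<dots> \<le> t (Suc ?v) (Suc i)" using interlacing_antimono[OF it] that(3) by simp
    also have "\<dots> \<le> t ?v i" using interlacingD(2)[OF it] .
    finally show ?thesis using iff[OF that(1)] by simp
  qed
  ultimately show ?thesis by (auto simp: ssyt_def tableau_of_def)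
qed

lemma skew_schur_eq_card_chains:
  assumes shape: "skew_shape lam \<mu>" and rows: "\<And>r. n \<le> r \<Longrightarrow> lam r = 0"
    and N: "\<And>k. N \<le> k \<Longrightarrow> Poly_Mapping.lookup \<alpha> k = 0"
  shows "skew_schur lam \<mu> \<alpha> = int (card {t \<in> chains n lam \<mu> N. chain_weight n t = int \<circ> Poly_Mapping.lookup \<alpha>})"
proof -
  let ?C = "{t \<in> chains n lam \<mu> N. chain_weight n t = int \<circ> Poly_Mapping.lookup \<alpha>}"
  have to: "chain_of lam \<mu> T \<in> ?C" if T: "T \<in> ssyt_content lam \<mu> \<alpha>" for T
  proof -
    let ?t = "chain_of lam \<mu> T"
    have ssyt: "T \<in> ssyt lam \<mu>" and content: "\<And>k. card {b \<in> skew_diagram lam \<mu>. T b = k} = Poly_Mapping.lookup \<alpha> k"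
      using T by (auto simp: ssyt_content_def)
    note enc = encodes_chain_of[OF shape ssyt]
    note il = ssyt_encodes_interlacing[OF shape rows ssyt enc]
    have fin: "finite (skew_diagram lam \<mu>)"
      using shape by (intro finite_skew_diagram) (simp add: skew_shape_def)
    have "?t k = lam" if k: "N \<le> k" for k
    proof
      fix r
      show "?t k r = lam r"
      proof (rule ccontr)
        assume "?t k r \<noteq> lam r"
        then have j: "\<mu> r \<le> ?t k r" "?t k r < lam r"
          using enc by (auto simp: encodes_def order_le_less)
        \<comment> \<open>The first cell of row \<open>r\<close> missing at level \<open>k\<close>
          would carry a letter that is at least \<open>N\<close>, whose prescribed multiplicity is
          0.\<close>
        then have "\<not> T (r, ?t k r) < k"
          using enc by (auto simp: encodes_def)
        then have "card {b \<in> skew_diagram lam \<mu>. T b = T (r, ?t k r)} = 0"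
          using content N k by simp
        then show False using fin j by (auto simp: skew_diagram_def)
      qed
    qed
    moreover have "chain_weight n ?t = int \<circ> Poly_Mapping.lookup \<alpha>"
      using card_letter[where n = n, OF enc rows interlacingD(1)[OF il(1)]] content by (auto simp: fun_eq_iff)
    ultimately show ?thesis using il by (simp add: chains_def)
  qed
  have inverse: "tableau_of lam \<mu> t \<in> ssyt_content lam \<mu> \<alpha>" if t: "t \<in> ?C" for t
  proof -
    have il: "interlacing n t" using t by (simp add: chains_def)
    have "t \<in> chains n lam \<mu> N" using t by simp
    from card_letter[where n = n, OF encodes_tableau_of[OF this] rows interlacingD(1)[OF il]] tableau_of_ssyt[OF this] t
    show ?thesis by (simp add: ssyt_content_def fun_eq_iff)
  qed
  have "bij_betw (chain_of lam \<mu>) (ssyt_content lam \<mu> \<alpha>) ?C"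
  proof (rule bij_betw_byWitness[where f' = "tableau_of lam \<mu>"])
    show "\<forall>T\<in>ssyt_content lam \<mu> \<alpha>. tableau_of lam \<mu> (chain_of lam \<mu> T) = T"
    proof
      fix T assume T: "T \<in> ssyt_content lam \<mu> \<alpha>"
      then have "T \<in> ssyt lam \<mu>" "T \<in> extensional (skew_diagram lam \<mu>)"
        by (auto simp: ssyt_content_def ssyt_def)
      then show "tableau_of lam \<mu> (chain_of lam \<mu> T) = T"
        using to[OF T] encodes_tableau_of[of "chain_of lam \<mu> T" n lam \<mu> N] encodes_chain_of[OF shape, of T]
        by (intro encodes_tableau_unique) (auto simp: tableau_of_def)
    qed
    show "\<forall>t\<in>?C. chain_of lam \<mu> (tableau_of lam \<mu> t) = t"
      using encodes_tableau_of[of _ n lam \<mu> N] encodes_chain_of[OF shape tableau_of_ssyt[of _ n lam \<mu> N]]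
        encodes_chain_unique by blast
  qed (use to inverse in auto)
  then show ?thesis
    by (simp add: skew_schur_def bij_betw_same_card)
qed

lemma chain_weight_nonneg: "interlacing n t \<Longrightarrow> 0 \<le> chain_weight n t k"
  unfolding chain_weight_def right_cells_def using interlacingD(1) by (force intro: sum_mono)

lemma skew_schur_product:
  assumes "skew_shape lam \<mu>" "skew_shape \<nu> \<rho>"
    and rows: "\<And>r. n \<le> r \<Longrightarrow> lam r = 0" "\<And>r. n \<le> r \<Longrightarrow> \<nu> r = 0"
    and N: "\<And>k. N \<le> k \<Longrightarrow> Poly_Mapping.lookup \<alpha> k = 0"
  shows "(skew_schur lam \<mu> \<odot> skew_schur \<nu> \<rho>) \<alpha>
    = num_pairs n lam \<mu> \<nu> \<rho> N (int \<circ> Poly_Mapping.lookup \<alpha>)"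
proof -
  let ?I = "{(\<beta>, \<gamma>). \<beta> + \<gamma> = \<alpha>}"
  let ?C = "\<lambda>lam \<mu> \<beta>. {t \<in> chains n lam \<mu> N. chain_weight n t = int \<circ> Poly_Mapping.lookup \<beta>}"
  let ?Z = "{(t, u) \<in> chains n lam \<mu> N \<times> chains n \<nu> \<rho> N. weight n t u = int \<circ> Poly_Mapping.lookup \<alpha>}"
  \<comment> \<open>The content of a chain as an exponent vector. Grouping pairs of chains by their
    two contents turns the count into the convolution.\<close>
  define pm where "pm t = Abs_poly_mapping (\<lambda>k. nat (chain_weight n t k))" for t
  have pm: "int \<circ> Poly_Mapping.lookup (pm t) = chain_weight n t" if t: "t \<in> chains n lam' \<mu>' N" for t lam' \<mu>'
  proof -
    have "k < N" if "chain_weight n t k \<noteq> 0" for k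
      using t that by (cases "k < N") (simp_all add: chains_def chain_weight_def)
    then have "{k. nat (chain_weight n t k) \<noteq> 0} \<subseteq> {..<N}"
      by force
    then have "finite {k. nat (chain_weight n t k) \<noteq> 0}" by (rule finite_subset) simp
    then show ?thesis
      using t chain_weight_nonneg[of n t] by (auto simp: pm_def chains_def fun_eq_iff)
  qed
  have pm_iff: "chain_weight n t = int \<circ> Poly_Mapping.lookup \<beta> \<longleftrightarrow> pm t = \<beta>" if "t \<in> chains n lam' \<mu>' N" for t \<beta> lam' \<mu>'
    unfolding pm[OF that, symmetric] by (auto simp: fun_eq_iff poly_mapping_eq_iff)
  have weight: "weight n t u k = chain_weight n t k + chain_weight n u k" for t u k
    by (simp add: weight_def chain_weight_def)
  have sum_iff: "weight n t u = int \<circ> Poly_Mapping.lookup \<alpha> \<longleftrightarrow> pm t + pm u = \<alpha>"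
    if "t \<in> chains n lam \<mu> N" "u \<in> chains n \<nu> \<rho> N" for t u
  proof -
    have "weight n t u = int \<circ> Poly_Mapping.lookup (pm t + pm u)"
      using fun_cong[OF pm[OF that(1)]] fun_cong[OF pm[OF that(2)]]
      by (simp add: fun_eq_iff weight lookup_add)
    then show ?thesis by (auto simp: fun_eq_iff poly_mapping_eq_iff)
  qed
  have "(skew_schur lam \<mu> \<odot> skew_schur \<nu> \<rho>) \<alpha> = (\<Sum>p\<in>?I. \<Sum>z\<in>{z \<in> ?Z. (\<lambda>(t, u). (pm t, pm u)) z = p}. 1)"
    unfolding series_times_def
  proof (rule sum.cong)
    fix p assume p: "p \<in> ?I"
    obtain \<beta> \<gamma> where [simp]: "p = (\<beta>, \<gamma>)" by (cases p)
    have \<alpha>: "\<alpha> = \<beta> + \<gamma>" using p by simp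
    have 0: "Poly_Mapping.lookup \<beta> k = 0" "Poly_Mapping.lookup \<gamma> k = 0" if "N \<le> k" for k
      using N[OF that] by (auto simp: \<alpha> lookup_add)
    have "{z \<in> ?Z. (\<lambda>(t, u). (pm t, pm u)) z = p} = ?C lam \<mu> \<beta> \<times> ?C \<nu> \<rho> \<gamma>"
      using pm_iff sum_iff p by auto
    then show "(case p of (\<beta>, \<gamma>) \<Rightarrow> skew_schur lam \<mu> \<beta> * skew_schur \<nu> \<rho> \<gamma>)
        = (\<Sum>z\<in>{z \<in> ?Z. (\<lambda>(t, u). (pm t, pm u)) z = p}. 1)"
      using skew_schur_eq_card_chains[OF assms(1) rows(1) 0(1)] skew_schur_eq_card_chains[OF assms(2) rows(2) 0(2)]
      by (simp add: card_cartesian_product)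
  qed simp
  also have "\<dots> = (\<Sum>z\<in>?Z. 1)"
  proof (rule sum.group)
    show "finite ?Z"
      by (rule finite_subset[of _ "chains n lam \<mu> N \<times> chains n \<nu> \<rho> N"]) (auto simp: finite_chains)
    show "(\<lambda>(t, u). (pm t, pm u)) ` ?Z \<subseteq> ?I"
      using sum_iff by auto
  qed (rule finite_series_times_index)
  finally show ?thesis by (simp add: num_pairs_def)
qed

lemma schur_eq_num_pairs:
  assumes "is_partition \<kappa>" "\<And>i. N \<le> i \<Longrightarrow> \<kappa> i = 0"
    and N: "\<And>k. N \<le> k \<Longrightarrow> Poly_Mapping.lookup \<alpha> k = 0"
  shows "schur \<kappa> \<alpha> = num_pairs N \<kappa> (\<lambda>_. 0) (\<lambda>_. 0) (\<lambda>_. 0) N (int \<circ> Poly_Mapping.lookup \<alpha>)"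
proof -
  let ?C = "{t \<in> chains N \<kappa> (\<lambda>_. 0) N. chain_weight N t = int \<circ> Poly_Mapping.lookup \<alpha>}"
  have "skew_shape \<kappa> (\<lambda>_. 0)"
    using assms(1) by (simp add: skew_shape_def is_partition_def antimono_def)
  then have "schur \<kappa> \<alpha> = int (card ?C)"
    using skew_schur_eq_card_chains[OF _ assms(2) N] by (simp add: schur_def)
  also have "card ?C = card ((\<lambda>t. (t, \<lambda>_ _. 0)) ` ?C)"
    by (rule card_image[symmetric]) (simp add: inj_on_def)
  also have "(\<lambda>t. (t, \<lambda>_ _. 0)) ` ?C = {(t, u) \<in> chains N \<kappa> (\<lambda>_. 0) N \<times> chains N (\<lambda>_. 0) (\<lambda>_. 0) N.
      weight N t u = int \<circ> Poly_Mapping.lookup \<alpha>}"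
  proof -
    have "weight N t (\<lambda>_ _. 0) = chain_weight N t" for t
      by (simp add: weight_def chain_weight_def fun_eq_iff)
    then show ?thesis by (auto simp: chains_0)
  qed
  finally show ?thesis by (simp add: num_pairs_def)
qed

section \<open>Schur nonnegativity\<close>

lemma right_cells_0: "right_cells n 0 x = int (\<Sum>r<n. x r)"
  by (simp add: right_cells_def)

text \<open>The weights decrease weakly, so a nonzero one at \<open>i\<close> accounts for at least
  \<open>Suc i\<close> cells, more than the bound \<open>M\<close> allows.\<close>

lemma yamanouchi_support:
  assumes t: "t \<in> chains n lam \<mu> N" and u: "u \<in> chains n \<nu> \<rho> N" and yam: "yamanouchi n t u"
    and M: "(\<Sum>r<n. lam r + \<nu> r) \<le> M" and i: "M \<le> i"
  shows "weight n t u i = 0"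
proof (rule ccontr)
  assume "weight n t u i \<noteq> 0"
  have it: "interlacing n t" and iu: "interlacing n u"
    using t u by (auto simp: chains_def)
  have "1 \<le> weight n t u i"
    using weight_nonneg[OF it iu, of i] \<open>weight n t u i \<noteq> 0\<close> by simp
  then have ge: "1 \<le> weight n t u l" if "l \<le> i" for l
    using lift_Suc_antimono_le[of "weight n t u", OF yamanouchi_weight_antimono[OF yam] that] by linarith
  have "int (Suc i) \<le> (\<Sum>l\<le>i. weight n t u l)"
    using sum_mono[of "{..i}" "\<lambda>_. 1" "weight n t u"] ge by simp
  also have "\<dots> = right_cells n 0 (t (Suc i)) - right_cells n 0 (t 0) + (right_cells n 0 (u (Suc i)) - right_cells n 0 (u 0))"
    by (induction i) (simp_all add: weight_def)
  also have "\<dots> \<le> right_cells n 0 (t (Suc i)) + right_cells n 0 (u (Suc i))"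
  proof -
    have "0 \<le> right_cells n 0 x" for x
      by (simp only: right_cells_0 of_nat_0_le_iff)
    from this[of "t 0"] this[of "u 0"] show ?thesis by simp
  qed
  also have "\<dots> = int (\<Sum>r<n. t (Suc i) r + u (Suc i) r)"
    by (simp add: right_cells_0 sum.distrib)
  also have "\<dots> \<le> int (\<Sum>r<n. lam r + \<nu> r)"
  proof -
    have "x k r \<le> l r" if "x \<in> chains n l m N" for x l m k r
      using interlacing_mono[of n x k "max k N" r] that by (simp add: chains_def)
    from this[OF t] this[OF u] show ?thesis
      by (intro of_nat_mono sum_mono add_mono) auto
  qed
  finally have "Suc i \<le> (\<Sum>r<n. lam r + \<nu> r)"
    by (simp only: of_nat_le_iff)
  then show False using M i by linarith
qed

text \<open>The number \<open>N\<close> of letters must grow with \<open>\<alpha>\<close>, whereas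
  \<open>schur_nonnegative\<close> asks for one choice of \<open>P\<close> and \<open>c\<close>.
  This makes the coefficients independent of \<open>N\<close>.\<close>

lemma yamanouchi_chains_eq:
  assumes M: "(\<Sum>r<n. lam r + \<nu> r) \<le> M" and MN: "M \<le> N"
  shows "{(t, u) \<in> chains n lam \<mu> N \<times> chains n \<nu> \<rho> N. yamanouchi n t u \<and> weight n t u = w}
    = {(t, u) \<in> chains n lam \<mu> M \<times> chains n \<nu> \<rho> M. yamanouchi n t u \<and> weight n t u = w}"
proof -
  have "t \<in> chains n lam \<mu> M \<and> u \<in> chains n \<nu> \<rho> M"
    if t: "t \<in> chains n lam \<mu> N" and u: "u \<in> chains n \<nu> \<rho> N" and yam: "yamanouchi n t u" for t u
  proof -
    have it: "interlacing n t" and iu: "interlacing n u"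
      using t u by (auto simp: chains_def)
    have stable: "x i = x (Suc i)"
      if x: "interlacing n x" "right_cells n 0 (x (Suc i)) = right_cells n 0 (x i)" for x i
    proof
      fix r
      have "(\<Sum>r<n. x (Suc i) r) = (\<Sum>r<n. x i r)"
        using x(2) unfolding right_cells_0 of_nat_eq_iff .
      then show "x i r = x (Suc i) r"
        using sum_mono_inv[of "x i" "{..<n}" "x (Suc i)" r] interlacingD(1,3)[OF x(1)]
        by (cases "r < n") auto
    qed
    have const: "t i = t (Suc i) \<and> u i = u (Suc i)" if i: "M \<le> i" for i
    proof -
      have "right_cells n 0 (x i) \<le> right_cells n 0 (x (Suc i))" if "interlacing n x" for x
        unfolding right_cells_def by (intro sum_mono) (use interlacingD(1)[OF that] in simp)
      from this[OF it] this[OF iu] show ?thesis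
        using yamanouchi_support[OF t u yam M i] stable[OF it, of i] stable[OF iu, of i]
        by (simp add: weight_def)
    qed
    have shift: "t i = t (i + d) \<and> u i = u (i + d)" if "M \<le> i" for i d
    proof (induction d)
      case (Suc d)
      then show ?case using const[of "i + d"] that by simp
    qed simp
    have last: "t (i + N) = lam" "u (i + N) = \<nu>" for i
      by (rule chainsD(3)[OF t le_add2], rule chainsD(3)[OF u le_add2])
    have "t i = lam \<and> u i = \<nu>" if "M \<le> i" for i
      using shift[OF that, of N] unfolding last .
    then show ?thesis
      by (blast intro: chainsI it iu chainsD(2)[OF t] chainsD(2)[OF u])
  qed
  moreover have "chains n lam \<mu> M \<subseteq> chains n lam \<mu> N" "chains n \<nu> \<rho> M \<subseteq> chains n \<nu> \<rho> N"
    using MN by (auto simp: chains_def)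
  ultimately show ?thesis by blast
qed

section \<open>Bounds on rows and letters, and coordinatewise operations on shapes\<close>

lemma partition_rows:
  assumes "is_partition lam"
  obtains n where "\<And>r. n \<le> r \<Longrightarrow> lam r = 0"
proof -
  obtain n where "\<And>r. lam r \<noteq> 0 \<Longrightarrow> r < n"
    using assms by (auto simp: is_partition_def finite_nat_set_iff_bounded)
  then show ?thesis using that[of n] by (meson not_less)
qed

lemma skew_shapes_rows:
  assumes "skew_shape lam \<mu>" "skew_shape \<nu> \<rho>"
  obtains n where "\<And>r. n \<le> r \<Longrightarrow> lam r = 0" "\<And>r. n \<le> r \<Longrightarrow> \<nu> r = 0"
    "\<And>r. n \<le> r \<Longrightarrow> \<mu> r = 0" "\<And>r. n \<le> r \<Longrightarrow> \<rho> r = 0"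
proof -
  have p: "is_partition lam" "is_partition \<nu>" and le: "\<mu> r \<le> lam r" "\<rho> r \<le> \<nu> r" for r
    using assms by (auto simp: skew_shape_def)
  obtain n1 where n1: "\<And>r. n1 \<le> r \<Longrightarrow> lam r = 0" by (rule partition_rows[OF p(1)]) (rule that)
  obtain n2 where n2: "\<And>r. n2 \<le> r \<Longrightarrow> \<nu> r = 0" by (rule partition_rows[OF p(2)]) (rule that)
  have rows: "lam r = 0" "\<nu> r = 0" if "max n1 n2 \<le> r" for r
    using that n1[of r] n2[of r] by auto
  have rows': "\<mu> r = 0" "\<rho> r = 0" if "max n1 n2 \<le> r" for r
    using rows[OF that] le[of r] by simp_all
  show ?thesis
    by (rule that[of "max n1 n2"]) (rule rows rows', assumption)+
qed

lemma lookup_bound: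
  fixes \<alpha> :: "nat \<Rightarrow>\<^sub>0 nat"
  obtains N where "\<And>k. N \<le> k \<Longrightarrow> Poly_Mapping.lookup \<alpha> k = 0"
proof -
  obtain m where m: "\<And>k. k \<in> Poly_Mapping.keys \<alpha> \<Longrightarrow> k < m"
    using finite_keys[of \<alpha>] by (auto simp: finite_nat_set_iff_bounded)
  have "Poly_Mapping.lookup \<alpha> k = 0" if "m \<le> k" for k
    using m[of k] that by (auto simp: in_keys_iff)
  then show ?thesis by (rule that)
qed

lemma skew_shape_map2:
  fixes f :: "nat \<Rightarrow> nat \<Rightarrow> nat"
  assumes "skew_shape lam \<mu>" "skew_shape \<nu> \<rho>"
    and mono: "\<And>a b a' b'. a \<le> a' \<Longrightarrow> b \<le> b' \<Longrightarrow> f a b \<le> f a' b'" and "f 0 0 = 0"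
  shows "skew_shape (\<lambda>i. f (lam i) (\<nu> i)) (\<lambda>i. f (\<mu> i) (\<rho> i))"
proof -
  have "is_partition (\<lambda>i. f (a i) (b i))" if "is_partition a" "is_partition b" for a b
  proof -
    have "{i. f (a i) (b i) \<noteq> 0} \<subseteq> {i. a i \<noteq> 0} \<union> {i. b i \<noteq> 0}"
    proof
      fix i assume "i \<in> {i. f (a i) (b i) \<noteq> 0}"
      then show "i \<in> {i. a i \<noteq> 0} \<union> {i. b i \<noteq> 0}"
        using \<open>f 0 0 = 0\<close> by (cases "a i = 0"; cases "b i = 0") simp_all
    qed
    moreover have "finite ({i. a i \<noteq> 0} \<union> {i. b i \<noteq> 0})" "antimono a" "antimono b"
      using that by (auto simp only: is_partition_def finite_Un)
    moreover from this(2,3) have "antimono (\<lambda>i. f (a i) (b i))"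
      by (auto simp: antimono_def intro: mono)
    ultimately show ?thesis
      unfolding is_partition_def by (blast intro: finite_subset)
  qed
  then show ?thesis using assms(1,2) mono by (simp add: skew_shape_def)
qed

lemma skew_shape_max: "skew_shape lam \<mu> \<Longrightarrow> skew_shape \<nu> \<rho> \<Longrightarrow>
    skew_shape (\<lambda>r. max (lam r) (\<nu> r)) (\<lambda>r. max (\<mu> r) (\<rho> r))"
  by (rule skew_shape_map2) auto

lemma skew_shape_min: "skew_shape lam \<mu> \<Longrightarrow> skew_shape \<nu> \<rho> \<Longrightarrow>
    skew_shape (\<lambda>r. min (lam r) (\<nu> r)) (\<lambda>r. min (\<mu> r) (\<rho> r))"
  by (rule skew_shape_map2) auto

lemma schur_nonnegative_max_min:
  assumes shape: "skew_shape lam \<mu>" "skew_shape \<nu> \<rho>"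
  shows "schur_nonnegative
    (skew_schur (\<lambda>r. max (lam r) (\<nu> r)) (\<lambda>r. max (\<mu> r) (\<rho> r)) \<odot>
       skew_schur (\<lambda>r. min (lam r) (\<nu> r)) (\<lambda>r. min (\<mu> r) (\<rho> r))
     - skew_schur lam \<mu> \<odot> skew_schur \<nu> \<rho>)"
proof -
  let ?l = "\<lambda>r. max (lam r) (\<nu> r)" and ?m = "\<lambda>r. max (\<mu> r) (\<rho> r)"
    and ?l' = "\<lambda>r. min (lam r) (\<nu> r)" and ?m' = "\<lambda>r. min (\<mu> r) (\<rho> r)"
  have shape': "skew_shape ?l ?m" "skew_shape ?l' ?m'"
    using skew_shape_max[OF shape] skew_shape_min[OF shape] .
  obtain n where rows: "\<And>r. n \<le> r \<Longrightarrow> lam r = 0" "\<And>r. n \<le> r \<Longrightarrow> \<nu> r = 0"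
    by (rule skew_shapes_rows[OF shape]) (rule that)
  define M where "M = (\<Sum>r<n. lam r + \<nu> r)"
  have M: "(\<Sum>r<n. lam r + \<nu> r) \<le> M" "(\<Sum>r<n. ?l r + ?l' r) \<le> M"
    unfolding M_def by (auto intro!: sum_mono)
  let ?X = "\<lambda>N w. {(t, u) \<in> chains n ?l ?m N \<times> chains n ?l' ?m' N. yamanouchi n t u \<and> weight n t u = w}"
  let ?Y = "\<lambda>N w. {(t, u) \<in> chains n lam \<mu> N \<times> chains n \<nu> \<rho> N. yamanouchi n t u \<and> weight n t u = w}"
  \<comment> \<open>The weights from the maximum and minimum suffice for both products: by
    \<open>transfer\<close>, every Yamanouchi weight of the original pair occurs among them.\<close>
  define P where "P = (\<lambda>(t, u) i. nat (weight n t u i)) `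
    {(t, u) \<in> chains n ?l ?m M \<times> chains n ?l' ?m' M. yamanouchi n t u}"
  define c where "c \<kappa> = int (card (?X M (int \<circ> \<kappa>))) - int (card (?Y M (int \<circ> \<kappa>)))" for \<kappa>
  have finP: "finite P"
    unfolding P_def
    by (intro finite_imageI finite_subset[OF _ finite_cartesian_product[OF finite_chains finite_chains]]) auto
  have P: "antimono \<kappa>" "M \<le> i \<Longrightarrow> \<kappa> i = 0" if "\<kappa> \<in> P" for \<kappa> i
  proof -
    obtain t u where t: "t \<in> chains n ?l ?m M" and u: "u \<in> chains n ?l' ?m' M"
      and yam: "yamanouchi n t u" and \<kappa>: "\<kappa> = (\<lambda>i. nat (weight n t u i))"
      using \<open>\<kappa> \<in> P\<close> by (auto simp: P_def)
    show "antimono \<kappa>"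
      unfolding \<kappa> antimono_iff_le_Suc using yamanouchi_weight_antimono[OF yam] by (simp add: nat_mono)
    show "M \<le> i \<Longrightarrow> \<kappa> i = 0"
      using weight_eq_0[OF t u] by (simp add: \<kappa>)
  qed
  have part: "is_partition \<kappa>" if "\<kappa> \<in> P" for \<kappa>
  proof -
    have "{i. \<kappa> i \<noteq> 0} \<subseteq> {..<M}"
      using P(2)[OF that] by (force simp: not_less[symmetric])
    then show ?thesis
      using P(1)[OF that] by (auto simp: is_partition_def intro: finite_subset)
  qed
  have transfer: "card (?Y N w) \<le> card (?X N w)" for N w
    by (rule card_yamanouchi_transfer)
  have "(skew_schur ?l ?m \<odot> skew_schur ?l' ?m' - skew_schur lam \<mu> \<odot> skew_schur \<nu> \<rho>) \<alpha>
      = (\<Sum>\<kappa>\<in>P. c \<kappa> * schur \<kappa> \<alpha>)" for \<alpha>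
  proof -
    obtain m where m: "\<And>k. m \<le> k \<Longrightarrow> Poly_Mapping.lookup \<alpha> k = 0"
      by (rule lookup_bound[of \<alpha>]) (rule that)
    define N where "N = max M m"
    have N: "M \<le> N" "\<And>k. N \<le> k \<Longrightarrow> Poly_Mapping.lookup \<alpha> k = 0"
      using m by (auto simp: N_def)
    have XN: "?X N w = ?X M w" and YN: "?Y N w = ?Y M w" for w
      by (rule yamanouchi_chains_eq[OF M(2) N(1)], rule yamanouchi_chains_eq[OF M(1) N(1)])
    have XP: "\<exists>\<kappa>\<in>P. w = int \<circ> \<kappa>" if ne: "?X N w \<noteq> {}" for w
    proof -
      obtain z where "z \<in> ?X M w" using ne unfolding XN by blast
      then obtain t u where tu: "(t, u) \<in> ?X M w" by (cases z) blast
      then have "w = int \<circ> (\<lambda>i. nat (weight n t u i))"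
        using weight_nonneg[of n t u] by (auto simp: chains_def fun_eq_iff)
      moreover have "(\<lambda>i. nat (weight n t u i)) \<in> P"
        using tu by (auto simp: P_def intro!: image_eqI[where x = "(t, u)"])
      ultimately show ?thesis by blast
    qed
    have YP: "\<exists>\<kappa>\<in>P. w = int \<circ> \<kappa>" if ne: "?Y N w \<noteq> {}" for w
    proof -
      have "finite (?Y N w)"
        by (rule finite_subset[OF _ finite_cartesian_product[OF finite_chains finite_chains]]) auto
      then have "card (?Y N w) \<noteq> 0"
        using ne by (simp only: card_eq_0_iff) blast
      then have "card (?X N w) \<noteq> 0"
        using transfer[of N w] by linarith
      then have "?X N w \<noteq> {}"
        by (metis card.empty)
      then show ?thesis by (rule XP)
    qed
    have P': "\<kappa> i = 0" if "\<kappa> \<in> P" "N \<le> i" for \<kappa> i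
      using P(2) that N(1) by simp
    have K: "schur \<kappa> \<alpha> = num_pairs N \<kappa> (\<lambda>_. 0) (\<lambda>_. 0) (\<lambda>_. 0) N (int \<circ> Poly_Mapping.lookup \<alpha>)" if "\<kappa> \<in> P" for \<kappa>
      by (rule schur_eq_num_pairs[OF part[OF that] P'[OF that] N(2)])
    have rows': "\<And>r. n \<le> r \<Longrightarrow> ?l r = 0" "\<And>r. n \<le> r \<Longrightarrow> ?l' r = 0"
      using rows by auto
    have "(skew_schur ?l ?m \<odot> skew_schur ?l' ?m') \<alpha> = (\<Sum>\<kappa>\<in>P. int (card (?X M (int \<circ> \<kappa>))) * schur \<kappa> \<alpha>)"
    proof -
      have prod: "(skew_schur ?l ?m \<odot> skew_schur ?l' ?m') \<alpha> = num_pairs n ?l ?m ?l' ?m' N (int \<circ> Poly_Mapping.lookup \<alpha>)"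
        by (rule skew_schur_product[OF shape']) (rule rows' N(2), assumption)+
      have "(skew_schur ?l ?m \<odot> skew_schur ?l' ?m') \<alpha> = (\<Sum>\<kappa>\<in>P. int (card (?X N (int \<circ> \<kappa>)))
          * num_pairs N \<kappa> (\<lambda>_. 0) (\<lambda>_. 0) (\<lambda>_. 0) N (int \<circ> Poly_Mapping.lookup \<alpha>))"
        unfolding prod
      proof (rule num_pairs_expansion[OF finP])
        fix t u assume "t \<in> chains n ?l ?m N" "u \<in> chains n ?l' ?m' N" "yamanouchi n t u"
        then have "(t, u) \<in> ?X N (weight n t u)" by simp
        then show "\<exists>\<kappa>\<in>P. weight n t u = int \<circ> \<kappa>" using XP by blast
      qed (rule P(1) P', assumption+)+
      then show ?thesis unfolding XN using K by simp
    qed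
    moreover have "(skew_schur lam \<mu> \<odot> skew_schur \<nu> \<rho>) \<alpha> = (\<Sum>\<kappa>\<in>P. int (card (?Y M (int \<circ> \<kappa>))) * schur \<kappa> \<alpha>)"
    proof -
      have prod: "(skew_schur lam \<mu> \<odot> skew_schur \<nu> \<rho>) \<alpha> = num_pairs n lam \<mu> \<nu> \<rho> N (int \<circ> Poly_Mapping.lookup \<alpha>)"
        by (rule skew_schur_product[OF shape]) (rule rows N(2), assumption)+
      have "(skew_schur lam \<mu> \<odot> skew_schur \<nu> \<rho>) \<alpha> = (\<Sum>\<kappa>\<in>P. int (card (?Y N (int \<circ> \<kappa>)))
          * num_pairs N \<kappa> (\<lambda>_. 0) (\<lambda>_. 0) (\<lambda>_. 0) N (int \<circ> Poly_Mapping.lookup \<alpha>))"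
        unfolding prod
      proof (rule num_pairs_expansion[OF finP])
        fix t u assume "t \<in> chains n lam \<mu> N" "u \<in> chains n \<nu> \<rho> N" "yamanouchi n t u"
        then have "(t, u) \<in> ?Y N (weight n t u)" by simp
        then show "\<exists>\<kappa>\<in>P. weight n t u = int \<circ> \<kappa>" using YP by blast
      qed (rule P(1) P', assumption+)+
      then show ?thesis unfolding YN using K by simp
    qed
    ultimately show ?thesis
      by (simp add: c_def left_diff_distrib sum_subtractf)
  qed
  moreover have "c \<kappa> \<ge> 0" for \<kappa>
    using transfer[of M "int \<circ> \<kappa>"] by (simp add: c_def)
  ultimately show ?thesis
    unfolding schur_nonnegative_def using finP part by (intro exI[of _ P] exI[of _ c]) auto
qed

text \<open>Shifting only the first \<open>n\<close> rows keeps the sequences finitely supported;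
  the other rows have no cells.\<close>

lemma skew_schur_shift:
  assumes shape: "skew_shape lam \<mu>" and rows: "\<And>r. n \<le> r \<Longrightarrow> lam r = 0"
  shows "skew_shape (\<lambda>r. if r < n then lam r + 1 else 0) (\<lambda>r. if r < n then \<mu> r + 1 else 0)"
    and "skew_schur (\<lambda>r. if r < n then lam r + 1 else 0) (\<lambda>r. if r < n then \<mu> r + 1 else 0) = skew_schur lam \<mu>"
proof -
  let ?s = "\<lambda>x r. if r < n then x r + 1 else (0::nat)"
  have part: "is_partition (?s x)" if "is_partition x" for x
  proof -
    have "finite {i. ?s x i \<noteq> 0}" by (rule finite_subset[of _ "{..<n}"]) auto
    then show ?thesis using that by (auto simp: is_partition_def antimono_def)
  qed
  then show shape': "skew_shape (?s lam) (?s \<mu>)"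
    using shape by (simp add: skew_shape_def)
  have rows\<mu>: "\<mu> r = 0" if "n \<le> r" for r
    using rows[OF that] shape by (metis skew_shape_def le_zero_eq)
  show "skew_schur (?s lam) (?s \<mu>) = skew_schur lam \<mu>"
  proof
    fix \<alpha> :: "nat \<Rightarrow>\<^sub>0 nat"
    obtain N where N: "\<And>k. N \<le> k \<Longrightarrow> Poly_Mapping.lookup \<alpha> k = 0"
      by (rule lookup_bound[of \<alpha>]) (rule that)
    let ?up = "\<lambda>t k. ?s (t k)" and ?down = "\<lambda>t k r. t k r - (1::nat)"
    let ?C = "\<lambda>lam \<mu>. {t \<in> chains n lam \<mu> N. chain_weight n t = int \<circ> Poly_Mapping.lookup \<alpha>}"
    have w: "chain_weight n (?up t) = chain_weight n t" for t
      by (rule ext) (simp add: chain_weight_def right_cells_def sum.distrib)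
    have up: "?up t \<in> chains n (?s lam) (?s \<mu>) N" "?down (?up t) = t" if "t \<in> chains n lam \<mu> N" for t
      using that by (auto simp: chains_def interlacing_def fun_eq_iff)
    have down: "?down t \<in> chains n lam \<mu> N" "?up (?down t) = t" if t: "t \<in> chains n (?s lam) (?s \<mu>) N" for t
    proof -
      have pos: "1 \<le> t k r" if "r < n" for k r
        using interlacing_mono[of n t 0 k r] t that by (simp add: chains_def)
      have "?s (?down t k) r = t k r" for k r
        using t pos[of r k] by (cases "r < n") (simp_all add: chains_def interlacing_def)
      then show "?up (?down t) = t" by blast
      show "?down t \<in> chains n lam \<mu> N"
        using t rows rows\<mu> by (auto simp: chains_def interlacing_def fun_eq_iff diff_le_mono)
    qed
    have "bij_betw ?up (?C lam \<mu>) (?C (?s lam) (?s \<mu>))"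
    proof (rule bij_betw_byWitness[where f' = ?down])
      show "?down ` ?C (?s lam) (?s \<mu>) \<subseteq> ?C lam \<mu>"
      proof
        fix t assume "t \<in> ?down ` ?C (?s lam) (?s \<mu>)"
        then obtain t' where t': "t' \<in> ?C (?s lam) (?s \<mu>)" "t = ?down t'" by blast
        then show "t \<in> ?C lam \<mu>"
          using w[of "?down t'"] down[of t'] by auto
      qed
    qed (use up down w in auto)
    then have "card (?C lam \<mu>) = card (?C (?s lam) (?s \<mu>))"
      by (rule bij_betw_same_card)
    then show "skew_schur (?s lam) (?s \<mu>) \<alpha> = skew_schur lam \<mu> \<alpha>"
      using skew_schur_eq_card_chains[OF shape rows N] skew_schur_eq_card_chains[OF shape' _ N, of n] by simp
  qed
qed

lemma series_times_commute: "f \<odot> g = g \<odot> f"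
  unfolding series_times_def
  by (intro ext sum.reindex_bij_witness[where i = prod.swap and j = prod.swap]) (auto simp: add.commute mult.commute)

lemma schur_nonnegative_trans:
  assumes "schur_nonnegative (f - g)" "schur_nonnegative (g - h)"
  shows "schur_nonnegative (f - h)"
proof -
  obtain P c where P: "finite P" "\<forall>\<kappa>\<in>P. is_partition \<kappa> \<and> c \<kappa> \<ge> 0"
    "f - g = (\<lambda>\<alpha>. \<Sum>\<kappa>\<in>P. c \<kappa> * schur \<kappa> \<alpha>)"
    using assms(1) by (auto simp: schur_nonnegative_def)
  obtain Q d where Q: "finite Q" "\<forall>\<kappa>\<in>Q. is_partition \<kappa> \<and> d \<kappa> \<ge> 0"
    "g - h = (\<lambda>\<alpha>. \<Sum>\<kappa>\<in>Q. d \<kappa> * schur \<kappa> \<alpha>)"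
    using assms(2) by (auto simp: schur_nonnegative_def)
  define e where "e \<kappa> = (if \<kappa> \<in> P then c \<kappa> else 0) + (if \<kappa> \<in> Q then d \<kappa> else 0)" for \<kappa>
  have "(f - h) \<alpha> = (\<Sum>\<kappa>\<in>P \<union> Q. e \<kappa> * schur \<kappa> \<alpha>)" for \<alpha>
  proof -
    have "(f - h) \<alpha> = (f - g) \<alpha> + (g - h) \<alpha>" by simp
    also have "\<dots> = (\<Sum>\<kappa>\<in>P. c \<kappa> * schur \<kappa> \<alpha>) + (\<Sum>\<kappa>\<in>Q. d \<kappa> * schur \<kappa> \<alpha>)"
      by (simp only: P(3) Q(3))
    also have "(\<Sum>\<kappa>\<in>P. c \<kappa> * schur \<kappa> \<alpha>) = (\<Sum>\<kappa>\<in>P \<union> Q. (if \<kappa> \<in> P then c \<kappa> else 0) * schur \<kappa> \<alpha>)"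
      by (rule sum.mono_neutral_cong_left) (use P Q in auto)
    also have "(\<Sum>\<kappa>\<in>Q. d \<kappa> * schur \<kappa> \<alpha>) = (\<Sum>\<kappa>\<in>P \<union> Q. (if \<kappa> \<in> Q then d \<kappa> else 0) * schur \<kappa> \<alpha>)"
      by (rule sum.mono_neutral_cong_left) (use P Q in auto)
    finally show ?thesis
      by (simp add: e_def distrib_right sum.distrib)
  qed
  then show ?thesis
    unfolding schur_nonnegative_def using P(1,2) Q(1,2)
    by (intro exI[of _ "P \<union> Q"] exI[of _ e]) (auto simp: e_def fun_eq_iff)
qed

lemma schur_nonnegative_refl: "schur_nonnegative (f - f)"
  unfolding schur_nonnegative_def by (intro exI[of _ "{}"]) auto

text \<open>The decrements and increments come from moving the second shape one column to the right before
  the cell transfer, and the larger shape back afterwards.\<close>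

lemma schur_nonnegative_shifted_max_min:
  assumes shape: "skew_shape lam \<mu>" "skew_shape \<nu> \<rho>"
  shows "schur_nonnegative
    (skew_schur (\<lambda>r. max (lam r - 1) (\<nu> r)) (\<lambda>r. max (\<mu> r - 1) (\<rho> r)) \<odot>
       skew_schur (\<lambda>r. min (lam r) (\<nu> r + 1)) (\<lambda>r. min (\<mu> r) (\<rho> r + 1))
     - skew_schur lam \<mu> \<odot> skew_schur \<nu> \<rho>)"
proof -
  obtain n where rows: "\<And>r. n \<le> r \<Longrightarrow> lam r = 0" "\<And>r. n \<le> r \<Longrightarrow> \<nu> r = 0"
    "\<And>r. n \<le> r \<Longrightarrow> \<mu> r = 0" "\<And>r. n \<le> r \<Longrightarrow> \<rho> r = 0"
    by (rule skew_shapes_rows[OF shape]) (rule that)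
  let ?s = "\<lambda>x r. if r < n then x r + 1 else (0::nat)"
  have shape': "skew_shape (\<lambda>r. max (lam r - 1) (\<nu> r)) (\<lambda>r. max (\<mu> r - 1) (\<rho> r))"
    by (rule skew_shape_map2[OF shape]) auto
  \<comment> \<open>The identity \<open>max x (y + 1) = max (x - 1) y + 1\<close> holds at
    \<open>x = 0\<close> as well, despite the truncated subtraction.\<close>
  have "(\<lambda>r. max (x r) (?s y r)) = ?s (\<lambda>r. max (x r - 1) (y r))"
    and "(\<lambda>r. min (x r) (?s y r)) = (\<lambda>r. min (x r) (y r + 1))"
    if "\<And>r. n \<le> r \<Longrightarrow> x r = 0" for x y :: "nat \<Rightarrow> nat"
    using that by (auto simp: fun_eq_iff max_def)
  note eqs = this[OF rows(1)] this[OF rows(3)]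
  have "skew_schur (?s (\<lambda>r. max (lam r - 1) (\<nu> r))) (?s (\<lambda>r. max (\<mu> r - 1) (\<rho> r)))
      = skew_schur (\<lambda>r. max (lam r - 1) (\<nu> r)) (\<lambda>r. max (\<mu> r - 1) (\<rho> r))"
    by (rule skew_schur_shift(2)[OF shape']) (simp add: rows)
  moreover have "skew_shape (?s \<nu>) (?s \<rho>)" "skew_schur (?s \<nu>) (?s \<rho>) = skew_schur \<nu> \<rho>"
    using skew_schur_shift[OF shape(2), of n] rows(2) by blast+
  ultimately show ?thesis
    using schur_nonnegative_max_min[OF shape(1), of "?s \<nu>" "?s \<rho>"] eqs by (simp only:)
qed

text \<open>For \<open>a = b + 1\<close> the shifted transfer alone gives \<open>b\<close> and
  \<open>b + 1\<close> in reversed order; the outer \<open>max\<close> and \<open>min\<close> put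
  them back. So differences 0 and 1 are fixed, and \<open>b \<le> a\<close> carries over to the new
  pair.\<close>

definition closer_max :: "nat \<Rightarrow> nat \<Rightarrow> nat" where
  "closer_max a b = max (max (a - 1) b) (min a (b + 1))"

definition closer_min :: "nat \<Rightarrow> nat \<Rightarrow> nat" where
  "closer_min a b = min (max (a - 1) b) (min a (b + 1))"

lemma schur_nonnegative_closer:
  assumes shape: "skew_shape lam \<mu>" "skew_shape \<nu> \<rho>"
  shows "skew_shape (\<lambda>r. closer_max (lam r) (\<nu> r)) (\<lambda>r. closer_max (\<mu> r) (\<rho> r))"
    and "skew_shape (\<lambda>r. closer_min (lam r) (\<nu> r)) (\<lambda>r. closer_min (\<mu> r) (\<rho> r))"
    and "schur_nonnegative
    (skew_schur (\<lambda>r. closer_max (lam r) (\<nu> r)) (\<lambda>r. closer_max (\<mu> r) (\<rho> r)) \<odot>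
       skew_schur (\<lambda>r. closer_min (lam r) (\<nu> r)) (\<lambda>r. closer_min (\<mu> r) (\<rho> r))
     - skew_schur lam \<mu> \<odot> skew_schur \<nu> \<rho>)"
proof -
  show "skew_shape (\<lambda>r. closer_max (lam r) (\<nu> r)) (\<lambda>r. closer_max (\<mu> r) (\<rho> r))"
    by (rule skew_shape_map2[OF shape]) (auto simp: closer_max_def)
  show "skew_shape (\<lambda>r. closer_min (lam r) (\<nu> r)) (\<lambda>r. closer_min (\<mu> r) (\<rho> r))"
    by (rule skew_shape_map2[OF shape]) (auto simp: closer_min_def)
  have 1: "skew_shape (\<lambda>r. max (lam r - 1) (\<nu> r)) (\<lambda>r. max (\<mu> r - 1) (\<rho> r))"
    by (rule skew_shape_map2[OF shape]) auto
  have 2: "skew_shape (\<lambda>r. min (lam r) (\<nu> r + 1)) (\<lambda>r. min (\<mu> r) (\<rho> r + 1))"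
    by (rule skew_shape_map2[OF shape]) auto
  show "schur_nonnegative
    (skew_schur (\<lambda>r. closer_max (lam r) (\<nu> r)) (\<lambda>r. closer_max (\<mu> r) (\<rho> r)) \<odot>
       skew_schur (\<lambda>r. closer_min (lam r) (\<nu> r)) (\<lambda>r. closer_min (\<mu> r) (\<rho> r))
     - skew_schur lam \<mu> \<odot> skew_schur \<nu> \<rho>)"
    using schur_nonnegative_trans[OF schur_nonnegative_max_min[OF 1 2] schur_nonnegative_shifted_max_min[OF shape]]
    by (simp only: closer_max_def closer_min_def)
qed

section \<open>Iteration down to ceiling and floor\<close>

lemma floor_half_sum_eq: "floor_half_sum x y = (\<lambda>i. (x i + y i) div 2)"
proof
  fix i
  show "floor_half_sum x y i = (x i + y i) div 2"
    using floor_divide_of_nat_eq[of "x i + y i" 2, where 'a = real] by (simp add: floor_half_sum_def)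
qed

lemma ceiling_half_sum_eq: "ceiling_half_sum x y = (\<lambda>i. (x i + y i + 1) div 2)"
proof
  fix i
  define m where "m = (x i + y i + 1) div 2"
  then have "2 * m = x i + y i \<or> 2 * m = x i + y i + 1" by linarith
  then have "2 * real m = real (x i) + real (y i) \<or> 2 * real m = real (x i) + real (y i) + 1"
    by (metis of_nat_1 of_nat_add of_nat_mult of_nat_numeral)
  then have "\<lceil>(real (x i) + real (y i)) / 2\<rceil> = int m"
    by (intro ceiling_unique) auto
  then show "ceiling_half_sum x y i = (x i + y i + 1) div 2"
    by (simp add: ceiling_half_sum_def m_def)
qed

text \<open>Induction on the largest difference of corresponding rows. A step preserves their sum,
  hence its halves, and lowers every difference above 1; once all are at most 1, the shapes are
  their own ceiling and floor.\<close>

lemma schur_nonnegative_halves: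
  assumes "skew_shape lam \<mu>" "skew_shape \<nu> \<rho>"
    and "\<And>r. \<nu> r \<le> lam r \<and> lam r \<le> \<nu> r + Suc d" "\<And>r. \<rho> r \<le> \<mu> r \<and> \<mu> r \<le> \<rho> r + Suc d"
  shows "schur_nonnegative
    (skew_schur (ceiling_half_sum lam \<nu>) (ceiling_half_sum \<mu> \<rho>) \<odot>
       skew_schur (floor_half_sum lam \<nu>) (floor_half_sum \<mu> \<rho>)
     - skew_schur lam \<mu> \<odot> skew_schur \<nu> \<rho>)"
  using assms
proof (induction d arbitrary: lam \<mu> \<nu> \<rho>)
  case 0
  have "ceiling_half_sum x y = x \<and> floor_half_sum x y = y"
    if xy: "\<And>r. y r \<le> x r \<and> x r \<le> y r + Suc 0" for x y
  proof -
    have "(x r + y r + 1) div 2 = x r \<and> (x r + y r) div 2 = y r" for r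
      using xy[of r] by linarith
    then show ?thesis by (simp add: ceiling_half_sum_eq floor_half_sum_eq)
  qed
  from this[OF 0(3)] this[OF 0(4)] show ?case
    by (simp only: schur_nonnegative_refl)
next
  case (Suc d)
  have sum: "closer_max a b + closer_min a b = a + b" if "b \<le> a" for a b
    using that by (auto simp: closer_max_def closer_min_def)
  then have halves: "ceiling_half_sum (\<lambda>r. closer_max (x r) (y r)) (\<lambda>r. closer_min (x r) (y r)) = ceiling_half_sum x y"
    "floor_half_sum (\<lambda>r. closer_max (x r) (y r)) (\<lambda>r. closer_min (x r) (y r)) = floor_half_sum x y"
    if "\<And>r. y r \<le> x r" for x y
    using that by (simp_all add: ceiling_half_sum_eq floor_half_sum_eq)
  have closer: "closer_min a b \<le> closer_max a b \<and> closer_max a b \<le> closer_min a b + Suc d"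
    if "b \<le> a \<and> a \<le> b + Suc (Suc d)" for a b
    using that by (auto simp: closer_max_def closer_min_def)
  note step = schur_nonnegative_closer[OF Suc.prems(1,2)]
  show ?case
    using schur_nonnegative_trans[OF Suc.IH[OF step(1,2) closer[OF Suc.prems(3)] closer[OF Suc.prems(4)]] step(3)]
    by (simp only: halves[where x = lam and y = \<nu>, OF conjunct1[OF Suc.prems(3)]]
        halves[where x = \<mu> and y = \<rho>, OF conjunct1[OF Suc.prems(4)]])
qed

theorem theorem4p1:
  fixes lam \<mu> \<nu> \<rho> :: "nat \<Rightarrow> nat"
  assumes "skew_shape lam \<mu>" and "skew_shape \<nu> \<rho>"
  shows "schur_nonnegative
    (skew_schur (floor_half_sum lam \<nu>) (floor_half_sum \<mu> \<rho>) \<odot>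
       skew_schur (ceiling_half_sum lam \<nu>) (ceiling_half_sum \<mu> \<rho>)
     - skew_schur lam \<mu> \<odot> skew_schur \<nu> \<rho>)"
proof -
  \<comment> \<open>One transfer comes first because the iteration starts from a pair in which the
    first shape contains the second, for outer and inner shapes alike.\<close>
  let ?max = "\<lambda>x y r. max (x r) (y r :: nat)" and ?min = "\<lambda>x y r. min (x r) (y r :: nat)"
  have shape: "skew_shape (?max lam \<nu>) (?max \<mu> \<rho>)" "skew_shape (?min lam \<nu>) (?min \<mu> \<rho>)"
    using skew_shape_max[OF assms] skew_shape_min[OF assms] .
  have le: "lam r \<le> lam 0" "\<nu> r \<le> \<nu> 0" "\<mu> r \<le> lam 0" "\<rho> r \<le> \<nu> 0" for r
    using assms by (auto simp: skew_shape_def is_partition_def antimono_def intro: le_trans)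
  have bound: "min (lam r) (\<nu> r) \<le> max (lam r) (\<nu> r) \<and> max (lam r) (\<nu> r) \<le> min (lam r) (\<nu> r) + Suc (lam 0 + \<nu> 0)"
    "min (\<mu> r) (\<rho> r) \<le> max (\<mu> r) (\<rho> r) \<and> max (\<mu> r) (\<rho> r) \<le> min (\<mu> r) (\<rho> r) + Suc (lam 0 + \<nu> 0)" for r
    using le[of r] by auto
  have "max a b + min a b = a + b" for a b :: nat by simp
  then have halves: "ceiling_half_sum (?max x y) (?min x y) = ceiling_half_sum x y"
    "floor_half_sum (?max x y) (?min x y) = floor_half_sum x y" for x y
    by (simp_all only: ceiling_half_sum_eq floor_half_sum_eq)
  then show ?thesis
    using schur_nonnegative_trans[OF schur_nonnegative_halves[of "?max lam \<nu>" "?max \<mu> \<rho>" "?min lam \<nu>"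
          "?min \<mu> \<rho>" "lam 0 + \<nu> 0", OF shape bound]
        schur_nonnegative_max_min[OF assms]]
    by (simp only: halves series_times_commute[of "skew_schur (floor_half_sum lam \<nu>) (floor_half_sum \<mu> \<rho>)"])
qed

end
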